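(* Let $A$ be a non-split, non-Lie, nilpotent (left) Leibniz algebra over $\mathbb{C}$ of dimension $5$ with $\dim(A^2)=1$. Then $A$ is isomorphic to a Leibniz algebra with basis $\{x_1,x_2,x_3,x_4,x_5\}$ whose nonzero products of basis vectors are given by one of the following: (1) $[x_1,x_4]=x_5,\ [x_2,x_3]=x_5,\ [x_2,x_4]=cx_5,\ [x_3,x_2]=cx_5,\ [x_4,x_1]=cx_5,\ [x_4,x_2]=x_5$, $c\in\mathbb{C}\setminus\{1,-1\}$. (2) $[x_1,x_4]=x_5,\ [x_2,x_3]=x_5,\ [x_2,x_4]=x_5,\ [x_3,x_2]=x_5,\ [x_4,x_1]=x_5,\ [x_4,x_2]=-x_5$. (3) $[x_1,x_4]=x_5,\ [x_2,x_3]=x_5,\ [x_2,x_4]=x_5,\ [x_3,x_2]=-x_5,\ [x_3,x_3]=x_5,\ [x_4,x_1]=-x_5,\ [x_4,x_2]=x_5$. (4) $[x_1,x_3]=x_5,\ [x_3,x_2]=x_5,\ [x_4,x_4]=x_5$. (5) $[x_1,x_3]=x_5,\ [x_2,x_2]=x_5,\ [x_2,x_3]=x_5,\ [x_3,x_1]=x_5,\ [x_3,x_2]=-x_5,\ [x_4,x_4]=x_5$. (6) $[x_1,x_2]=x_5,\ [x_2,x_1]=-x_5,\ [x_3,x_4]=x_5,\ [x_4,x_3]=-x_5,\ [x_4,x_4]=x_5$. (7) $[x_1,x_2]=x_5,\ [x_2,x_1]=-x_5,\ [x_3,x_4]=x_5,\ [x_4,x_3]=cx_5$, $c\in\mathbb{C}\setminus\{1,-1\}$.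 (8) $[x_1,x_2]=x_5,\ [x_2,x_1]=-x_5,\ [x_2,x_2]=x_5,\ [x_3,x_4]=x_5,\ [x_4,x_3]=-x_5,\ [x_4,x_4]=x_5$. (9) $[x_1,x_2]=x_5,\ [x_2,x_1]=-x_5,\ [x_2,x_2]=x_5,\ [x_3,x_4]=x_5,\ [x_4,x_3]=cx_5$, $c\in\mathbb{C}\setminus\{1,-1\}$. (10) $[x_1,x_2]=x_5,\ [x_2,x_1]=c_1x_5,\ [x_3,x_4]=x_5,\ [x_4,x_3]=c_2x_5$, $c_1,c_2\in\mathbb{C}\setminus\{1,-1\}$. (11) $[x_1,x_2]=x_5,\ [x_2,x_1]=-x_5,\ [x_3,x_3]=x_5,\ [x_4,x_4]=x_5$. (12) $[x_1,x_2]=x_5,\ [x_2,x_1]=-x_5,\ [x_2,x_2]=x_5,\ [x_3,x_3]=x_5,\ [x_4,x_4]=x_5$. (13) $[x_1,x_2]=x_5,\ [x_2,x_1]=cx_5,\ [x_3,x_3]=x_5,\ [x_4,x_4]=x_5$, $c\in\mathbb{C}\setminus\{1,-1\}$. (14) $[x_1,x_1]=x_5,\ [x_2,x_2]=x_5,\ [x_3,x_3]=x_5,\ [x_4,x_4]=x_5$.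
   Context: All algebras are over $\mathbb{C}$. A (left) Leibniz algebra is a $\mathbb{C}$-vector space $A$ with a bilinear product $[\,,\,]:A\times A\to A$ such that $[a,[b,c]]=[[a,b],c]+[b,[a,c]]$ for all $a,b,c\in A$. $A$ is a Lie algebra iff $Leib(A)=\mathrm{span}\{[a,a]\mid a\in A\}$ is zero; non-Lie means $Leib(A)\neq 0$. Put $A^1=A$, $A^i=[A,A^{i-1}]$ (span of products) for $i\ge 2$; $A$ is nilpotent if $A^m=0$ for some positive integer $m$. $A$ is split if it is a direct sum of two nontrivial (nonzero) ideals (two-sided), and non-split otherwise. Products of basis vectors not listed are zero (products listed with a coefficient $c$ or $c_i$ are zero when that coefficient is $0$). *)

theory Defs
  imports "HOL-Analysis.Analysis"
begin

text \<open>The algebra is the whole type \<open>'a\<close>; linearity in each argument is the library's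
  notion for the given complex scalar multiplication.\<close>

locale leibniz_algebra = vector_space scale
  for scale :: "complex \<Rightarrow> 'a::ab_group_add \<Rightarrow> 'a" +
  fixes bracket :: "'a \<Rightarrow> 'a \<Rightarrow> 'a"
  assumes linear_right: "Vector_Spaces.linear scale scale (\<lambda>b. bracket a b)"
    and linear_left: "Vector_Spaces.linear scale scale (\<lambda>a. bracket a b)"
    and leibniz: "bracket a (bracket b c) = bracket (bracket a b) c + bracket b (bracket a c)"
begin

definition Leib :: "'a set" where
  "Leib = span {bracket a a | a. True}"

definition non_Lie :: bool where
  "non_Lie \<longleftrightarrow> Leib \<noteq> {0}"

text \<open>\<open>lower_series i\<close> is $A^i$ for \<open>i \<ge> 1\<close>; the value at 0 is a convention and
  is never used.\<close>

fun lower_series :: "nat \<Rightarrow> 'a set" where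
  "lower_series 0 = UNIV"
| "lower_series (Suc 0) = UNIV"
| "lower_series (Suc (Suc n)) = span {bracket a b | a b. b \<in> lower_series (Suc n)}"

definition nilpotent_algebra :: bool where
  "nilpotent_algebra \<longleftrightarrow> (\<exists>m>0. lower_series m = {0})"

definition two_sided_ideal :: "'a set \<Rightarrow> bool" where
  "two_sided_ideal I \<longleftrightarrow>
     subspace I \<and> (\<forall>a. \<forall>u\<in>I. bracket a u \<in> I \<and> bracket u a \<in> I)"

definition split_algebra :: bool where
  "split_algebra \<longleftrightarrow>
     (\<exists>I J. two_sided_ideal I \<and> two_sided_ideal J \<and> I \<noteq> {0} \<and> J \<noteq> {0} \<and>
        I \<inter> J = {0} \<and> {u + v | u v. u \<in> I \<and> v \<in> J} = UNIV)"

text \<open>\<open>x 1, \<dots>, x 5\<close> is a basis; values of \<open>x\<close> at other indices are irrelevant.\<close>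

definition basis5 :: "(nat \<Rightarrow> 'a) \<Rightarrow> bool" where
  "basis5 x \<longleftrightarrow> inj_on x {1..5} \<and> independent (x ` {1..5}) \<and> span (x ` {1..5}) = UNIV"

text \<open>An entry \<open>((i, j), c)\<close> of the table \<open>T\<close> says $[x_i,x_j] = c\,x_5$; the product of
  basis vectors is zero for every pair \<open>(i, j)\<close> that is not listed.\<close>

definition products_given_by :: "(nat \<Rightarrow> 'a) \<Rightarrow> ((nat \<times> nat) \<times> complex) list \<Rightarrow> bool" where
  "products_given_by x T \<longleftrightarrow>
     (\<forall>i\<in>{1..5}. \<forall>j\<in>{1..5}. bracket (x i) (x j) =
        (case map_of T (i, j) of None \<Rightarrow> 0 | Some c \<Rightarrow> scale c (x 5)))"

end

definition leibniz_isomorphic ::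
  "(complex \<Rightarrow> 'a::ab_group_add \<Rightarrow> 'a) \<Rightarrow> ('a \<Rightarrow> 'a \<Rightarrow> 'a) \<Rightarrow>
   (complex \<Rightarrow> 'b::ab_group_add \<Rightarrow> 'b) \<Rightarrow> ('b \<Rightarrow> 'b \<Rightarrow> 'b) \<Rightarrow> bool" where
  "leibniz_isomorphic scaleA brA scaleB brB \<longleftrightarrow>
     (\<exists>f. Vector_Spaces.linear scaleA scaleB f \<and> bij f \<and>
        (\<forall>a b. f (brA a b) = brB (f a) (f b)))"

end

theory Submission
  imports Defs "HOL-Computational_Algebra.Fundamental_Theorem_Algebra"
begin

text \<open>
  Nilpotency makes the line \<open>A\<^sup>2 = \<langle>z\<rangle>\<close> central, so \<open>[a, b] = B(a, b) z\<close> for a bilinear form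
  \<open>B\<close>; non-splitness says that the two-sided radical of \<open>B\<close> is exactly \<open>\<langle>z\<rangle>\<close>, and being
  non-Lie says that \<open>B\<close> is not alternating. This reduces the claim to the congruence
  classification of bilinear forms on \<open>\<complex>\<^sup>4\<close>. Write \<open>B = S + K\<close> with \<open>S\<close> symmetric and \<open>K\<close> alternating.
  If \<open>K = 0\<close>, then \<open>S\<close> has an orthonormal basis. If \<open>K\<close> has rank two, one distinguishes by the
  rank of \<open>S\<close> on the kernel of \<open>K\<close>. If \<open>K\<close> is nondegenerate, the operator \<open>X\<close> with
  \<open>K(X u, v) = S(u, v)\<close> is skew for \<open>K\<close>: an eigenvector for \<open>l \<noteq> 0\<close> comes with one for \<open>-l\<close>, and
  either the two span a plane that splits off or they span a Lagrangian plane; otherwise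
  \<open>X\<close> is nilpotent, and is either regular or has square zero.
\<close>

subsection \<open>The tables of structure constants\<close>

type_synonym table = "((nat \<times> nat) \<times> complex) list"

definition entry :: "table \<Rightarrow> nat \<Rightarrow> nat \<Rightarrow> complex" where
  "entry T i j = (case map_of T (i, j) of None \<Rightarrow> 0 | Some c \<Rightarrow> c)"

inductive listed :: "table \<Rightarrow> bool" where
  t1: "c \<notin> {1, - 1} \<Longrightarrow>
    listed [((1,4), 1), ((2,3), 1), ((2,4), c), ((3,2), c), ((4,1), c), ((4,2), 1)]"
| t2: "listed [((1,4), 1), ((2,3), 1), ((2,4), 1), ((3,2), 1), ((4,1), 1), ((4,2), - 1)]"
| t3: "listed [((1,4), 1), ((2,3), 1), ((2,4), 1), ((3,2), - 1), ((3,3), 1), ((4,1), - 1), ((4,2), 1)]"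
| t4: "listed [((1,3), 1), ((3,2), 1), ((4,4), 1)]"
| t5: "listed [((1,3), 1), ((2,2), 1), ((2,3), 1), ((3,1), 1), ((3,2), - 1), ((4,4), 1)]"
| t6: "listed [((1,2), 1), ((2,1), - 1), ((3,4), 1), ((4,3), - 1), ((4,4), 1)]"
| t7: "c \<notin> {1, - 1} \<Longrightarrow> listed [((1,2), 1), ((2,1), - 1), ((3,4), 1), ((4,3), c)]"
| t8: "listed [((1,2), 1), ((2,1), - 1), ((2,2), 1), ((3,4), 1), ((4,3), - 1), ((4,4), 1)]"
| t9: "c \<notin> {1, - 1} \<Longrightarrow>
    listed [((1,2), 1), ((2,1), - 1), ((2,2), 1), ((3,4), 1), ((4,3), c)]"
| t10: "c1 \<notin> {1, - 1} \<Longrightarrow> c2 \<notin> {1, - 1} \<Longrightarrow>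
    listed [((1,2), 1), ((2,1), c1), ((3,4), 1), ((4,3), c2)]"
| t11: "listed [((1,2), 1), ((2,1), - 1), ((3,3), 1), ((4,4), 1)]"
| t12: "listed [((1,2), 1), ((2,1), - 1), ((2,2), 1), ((3,3), 1), ((4,4), 1)]"
| t13: "c \<notin> {1, - 1} \<Longrightarrow> listed [((1,2), 1), ((2,1), c), ((3,3), 1), ((4,4), 1)]"
| t14: "listed [((1,1), 1), ((2,2), 1), ((3,3), 1), ((4,4), 1)]"

lemma interval_4: "{1..4} = {1, 2, 3, 4::nat}" and interval_5: "{1..5} = {1, 2, 3, 4, 5::nat}"
  by auto

lemma sum_1_5: "(\<Sum>i\<in>{1..5::nat}. g i) = (\<Sum>i\<in>{1..4}. g i) + (g 5 :: 'a::comm_monoid_add)"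
  unfolding interval_4 interval_5 by (simp add: ac_simps)

lemma listed_entry_5:
  assumes "listed T"
  shows "map_of T (i, 5) = None" "map_of T (5, i) = None"
  using assms by (auto elim!: listed.cases)

text \<open>Solving the linear equations of each table forces all coefficients to vanish. This later
  yields the independence of any vectors whose products follow a table.\<close>

lemma listed_nondegenerate:
  assumes "listed T"
    and "\<And>j. j \<in> {1..4} \<Longrightarrow> (\<Sum>i\<in>{1..4}. a i * entry T i j) = 0"
    and "\<And>j. j \<in> {1..4} \<Longrightarrow> (\<Sum>i\<in>{1..4}. a i * entry T j i) = 0"
    and "i \<in> {1..4}"
  shows "a i = 0"
proof -
  have eqs: "a 1 * entry T 1 j + a 2 * entry T 2 j + a 3 * entry T 3 j + a 4 * entry T 4 j = 0"
      "a 1 * entry T j 1 + a 2 * entry T j 2 + a 3 * entry T j 3 + a 4 * entry T j 4 = 0"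
    if "j \<in> {1..4}" for j
    using assms(2,3)[OF that] unfolding interval_4 by (simp_all add: add.assoc)
  have "a 1 = 0 \<and> a 2 = 0 \<and> a 3 = 0 \<and> a 4 = 0"
    using assms(1) by cases (use eqs[of 1] eqs[of 2] eqs[of 3] eqs[of 4] in \<open>simp_all add: entry_def\<close>)
  then show ?thesis
    using assms(4) unfolding interval_4 by auto
qed

subsection \<open>Linear algebra\<close>

lemma csqrt_squared: "csqrt a * csqrt a = a"
  by (metis power2_csqrt power2_eq_square)

text \<open>A repeated vector is itself a nontrivial relation, so one hypothesis gives both
  injectivity and independence of the image.\<close>

lemma (in vector_space) independent_familyI:
  assumes "finite I" and zero: "\<And>a i. (\<Sum>i\<in>I. scale (a i) (x i)) = 0 \<Longrightarrow> i \<in> I \<Longrightarrow> a i = 0"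
  shows "inj_on x I \<and> independent (x ` I)"
proof
  show inj: "inj_on x I"
  proof (rule inj_onI, rule ccontr)
    fix i j
    assume ij: "i \<in> I" "j \<in> I" "x i = x j" "i \<noteq> j"
    define a :: "'c \<Rightarrow> 'a" where "a k = (if k = i then 1 else 0) - (if k = j then 1 else 0)" for k
    have "(\<Sum>k\<in>I. scale (a k) (x k)) = (\<Sum>k\<in>I. (if k = i then x k else 0) - (if k = j then x k else 0))"
      by (intro sum.cong) (auto simp: a_def)
    also have "\<dots> = 0"
      using ij assms(1) by (simp add: sum_subtractf)
    finally have "a i = 0"
      using zero ij(1) by blast
    then show False
      using ij(4) by (simp add: a_def)
  qed
  have "u v = 0" if "(\<Sum>v\<in>x ` I. scale (u v) v) = 0" "v \<in> x ` I" for u v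
    using that zero[of "u \<circ> x"] inj by (auto simp: sum.reindex)
  then show "independent (x ` I)"
    using assms(1) by (auto simp: dependent_finite)
qed

lemma five_vectors_dependent:
  fixes x :: "nat \<Rightarrow> complex^4"
  shows "\<exists>a. (\<exists>i\<le>4. a i \<noteq> 0) \<and> (\<Sum>i\<le>4. a i *s x i) = 0"
proof (rule ccontr)
  assume "\<not> ?thesis"
  then have "a i = 0" if "(\<Sum>i\<in>{..4}. a i *s x i) = 0" "i \<in> {..4}" for a i
    using that by auto
  then have "inj_on x {..4}" "vec.independent (x ` {..4})"
    using vec.independent_familyI[of "{..4}" x] by auto
  then have "card {..4::nat} \<le> vec.dim (UNIV :: (complex^4) set)"
    using vec.independent_card_le_dim[of "x ` {..4}" UNIV] by (simp add: card_image)
  then show False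
    by (simp add: vec_dim_card del: vec.dim_UNIV)
qed

lemma exists_outside_span:
  fixes F :: "(complex^4) set"
  assumes "finite F" "card F < 4"
  shows "\<exists>y. y \<notin> vec.span F"
proof (rule ccontr)
  assume "\<not> ?thesis"
  then have "vec.dim (UNIV :: (complex^4) set) \<le> card F"
    using assms by (intro vec.dim_le_card) auto
  then show False
    using assms by (simp add: vec_dim_card del: vec.dim_UNIV)
qed

section \<open>Spans of two vectors\<close>

definition combination :: "complex^4 \<Rightarrow> complex^4 \<Rightarrow> complex^4 \<Rightarrow> bool" where
  "combination u p q \<longleftrightarrow> (\<exists>a b. u = a *s p + b *s q)"

lemma combination_trans:
  assumes "combination u p q" "combination p r s" "combination q r s"
  shows "combination u r s"
proof -
  from assms obtain a b c d e f where "u = a *s p + b *s q" "p = c *s r + d *s s" "q = e *s r + f *s s"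
    unfolding combination_def by blast
  then have "u = (a * c + b * e) *s r + (a * d + b * f) *s s"
    by (simp add: vec.scale_right_distrib vec.scale_left_distrib)
  then show ?thesis
    unfolding combination_def by blast
qed

lemma combination_left: "combination p p q" and combination_right: "combination q p q"
proof -
  show "combination p p q"
    unfolding combination_def by (intro exI[of _ 1] exI[of _ 0]) simp
  show "combination q p q"
    unfolding combination_def by (intro exI[of _ 0] exI[of _ 1]) simp
qed

lemma combination_scale: "combination (a *s p) p q" "combination (b *s q) p q"
proof -
  show "combination (a *s p) p q"
    unfolding combination_def by (intro exI[of _ a] exI[of _ 0]) simp
  show "combination (b *s q) p q"
    unfolding combination_def by (intro exI[of _ 0] exI[of _ b]) simp
qed

lemma combinationI: "combination (a *s p + b *s q) p q"
  unfolding combination_def by blast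

definition indep :: "complex^4 \<Rightarrow> complex^4 \<Rightarrow> bool" where
  "indep p q \<longleftrightarrow> (\<forall>c d. c *s p + d *s q = 0 \<longrightarrow> c = 0 \<and> d = 0)"

lemma indep_commute: "indep p q \<longleftrightarrow> indep q p"
  unfolding indep_def by (metis add.commute)

lemma combination_commute: "combination u p q \<longleftrightarrow> combination u q p"
  unfolding combination_def by (metis add.commute)

subsection \<open>Bilinear forms\<close>

locale bilinear_form =
  fixes B :: "complex^4 \<Rightarrow> complex^4 \<Rightarrow> complex"
  assumes add_left: "B (u + v) w = B u w + B v w"
    and add_right: "B w (u + v) = B w u + B w v"
    and scale_left: "B (c *s u) w = c * B u w"
    and scale_right: "B w (c *s u) = c * B w u"
begin

lemma zero_left: "B 0 w = 0" and zero_right: "B w 0 = 0"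
  using scale_left[of 0 0 w] scale_right[of w 0 0] by auto

lemma minus_left: "B (- u) w = - B u w" and minus_right: "B w (- u) = - B w u"
  using add_left[of u "- u" w] add_right[of w u "- u"]
  by (simp_all add: zero_left zero_right eq_neg_iff_add_eq_0 add.commute)

lemma diff_left: "B (u - v) w = B u w - B v w" and diff_right: "B w (u - v) = B w u - B w v"
  using add_left[of u "- v" w] add_right[of w u "- v"] by (simp_all add: minus_left minus_right)

lemmas bilinear = add_left add_right scale_left scale_right zero_left zero_right
  minus_left minus_right diff_left diff_right

definition S :: "complex^4 \<Rightarrow> complex^4 \<Rightarrow> complex" where
  "S u v = (B u v + B v u) / 2"

definition K :: "complex^4 \<Rightarrow> complex^4 \<Rightarrow> complex" where
  "K u v = (B u v - B v u) / 2"

lemma S_commute: "S u v = S v u"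
  by (simp add: S_def add.commute)

lemma K_commute: "K u v = - K v u"
  by (simp add: K_def field_simps)

lemma K_self [simp]: "K u u = 0"
  by (simp add: K_def)

lemma B_eq: "B u v = S u v + K u v"
  by (simp add: S_def K_def field_simps)

lemma S_bilinear:
  "S (u + v) w = S u w + S v w" "S w (u + v) = S w u + S w v"
  "S (c *s u) w = c * S u w" "S w (c *s u) = c * S w u"
  "S 0 w = 0" "S w 0 = 0" "S (- u) w = - S u w" "S w (- u) = - S w u"
  "S (u - v) w = S u w - S v w" "S w (u - v) = S w u - S w v"
  by (simp_all add: S_def bilinear field_simps)

lemma K_bilinear:
  "K (u + v) w = K u w + K v w" "K w (u + v) = K w u + K w v"
  "K (c *s u) w = c * K u w" "K w (c *s u) = c * K w u"
  "K 0 w = 0" "K w 0 = 0" "K (- u) w = - K u w" "K w (- u) = - K w u"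
  "K (u - v) w = K u w - K v w" "K w (u - v) = K w u - K w v"
  by (simp_all add: K_def bilinear field_simps)

lemmas SK = S_bilinear K_bilinear

definition gram :: "(complex^4) list \<Rightarrow> table \<Rightarrow> bool" where
  "gram xs T \<longleftrightarrow> (\<forall>i\<in>{1..4}. \<forall>j\<in>{1..4}. B (xs ! (i - 1)) (xs ! (j - 1)) = entry T i j)"

text \<open>Independence of the vectors \<open>xs\<close> is supplied afterwards by
  \<open>listed_nondegenerate\<close>.\<close>

definition realizable :: bool where
  "realizable \<longleftrightarrow> (\<exists>xs T. listed T \<and> gram xs T)"

lemma realizableI: "listed T \<Longrightarrow> gram xs T \<Longrightarrow> realizable"
  by (auto simp: realizable_def)

lemma gram_Cons: "gram [a, b, c, d] T \<longleftrightarrow>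
   B a a = entry T 1 1 \<and> B a b = entry T 1 2 \<and> B a c = entry T 1 3 \<and> B a d = entry T 1 4 \<and>
   B b a = entry T 2 1 \<and> B b b = entry T 2 2 \<and> B b c = entry T 2 3 \<and> B b d = entry T 2 4 \<and>
   B c a = entry T 3 1 \<and> B c b = entry T 3 2 \<and> B c c = entry T 3 3 \<and> B c d = entry T 3 4 \<and>
   B d a = entry T 4 1 \<and> B d b = entry T 4 2 \<and> B d c = entry T 4 3 \<and> B d d = entry T 4 4"
proof -
  show ?thesis
    unfolding gram_def interval_4 by (simp add: conj_assoc)
qed

subsection \<open>Planes\<close>

text \<open>The blocks that occur are \<open>(m, c) = (- 1, 0)\<close>, where \<open>B\<close> is
  alternating, \<open>(- 1, 1)\<close>, and \<open>(m, 0)\<close> with \<open>m\<close> different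
  from 1 and -1.\<close>

definition plane :: "complex^4 \<Rightarrow> complex^4 \<Rightarrow> complex \<Rightarrow> complex \<Rightarrow> bool" where
  "plane p q m c \<longleftrightarrow> B p p = 0 \<and> B p q = 1 \<and> B q p = m \<and> B q q = c"

text \<open>If \<open>S p q = 0\<close>, the symmetric part has rank at most one and scaling
  suffices. Otherwise \<open>q\<close> is sheared along \<open>p\<close> to become isotropic; then
  only the ratio of \<open>B q p\<close> and \<open>B p q\<close> is left, and it avoids 1 and -1
  because neither \<open>K\<close> nor \<open>S\<close> vanishes.\<close>

lemma plane_isotropic:
  assumes K: "K p q \<noteq> 0" and S: "S p p = 0"
  shows "(S p p = 0 \<and> S p q = 0 \<and> S q q = 0) \<or>
    (\<exists>p' q'. combination p' p q \<and> combination q' p q \<and>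
      (plane p' q' (- 1) 1 \<or> (\<exists>c. c \<notin> {1, - 1} \<and> plane p' q' c 0)))"
proof (cases "S p q = 0")
  case True
  show ?thesis
  proof (cases "S q q = 0")
    case True
    then show ?thesis
      using S \<open>S p q = 0\<close> by simp
  next
    case False
    define r where "r = csqrt (S q q)"
    have r: "r \<noteq> 0" "r * r = S q q"
      using False by (auto simp: r_def csqrt_squared)
    let ?p = "(r / K p q) *s p" and ?q = "(1 / r) *s q"
    have "plane ?p ?q (- 1) 1"
      using r K S True False K_commute[of q p] S_commute[of q p]
      by (simp add: plane_def B_eq SK field_simps)
    then show ?thesis
      using combination_scale by blast
  qed
next
  case False
  \<comment> \<open>The root of \<open>S q q - 2 * t * S p q = 0\<close>, which makes
    \<open>q'\<close> isotropic.\<close>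
  define t where "t = S q q / (2 * S p q)"
  define q' where "q' = q - t *s p"
  have q': "combination q' p q"
    unfolding q'_def combination_def by (intro exI[of _ "- t"] exI[of _ 1]) simp
  have Sq: "S q' q' = 0" "S p q' = S p q" "K p q' = K p q"
    using False S S_commute[of q p] by (simp_all add: q'_def SK t_def)
  define s where "s = S p q"
  define k where "k = K p q"
  have sk: "s \<noteq> 0" "k \<noteq> 0"
    using False K by (auto simp: s_def k_def)
  have qp: "S q' p = s" "K q' p = - k"
    using Sq S_commute[of q' p] K_commute[of q' p] by (auto simp: s_def k_def)
  show ?thesis
  proof (cases "s + k = 0")
    case False
    let ?c = "(s - k) / (s + k)"
    let ?p = "(1 / (s + k)) *s p"
    have "plane ?p q' ?c 0"
      using False Sq qp S
      by (simp add: plane_def B_eq SK s_def[symmetric] k_def[symmetric]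
        add_divide_distrib[symmetric] diff_divide_distrib[symmetric])
    moreover have "?c \<noteq> 1" "?c \<noteq> - 1"
      using sk False by (auto simp: divide_eq_eq)
    ultimately show ?thesis
      using q' combination_scale by blast
  next
    case True
    \<comment> \<open>Here \<open>B p q'\<close> vanishes, so the two vectors change places; the
      factor comes from \<open>B q' p = 2 * s\<close>.\<close>
    let ?q = "(1 / (2 * s)) *s p"
    have "s = - k"
      using True by (simp add: eq_neg_iff_add_eq_0)
    then have "plane q' ?q 0 0"
      using sk Sq qp S by (simp add: plane_def B_eq SK s_def[symmetric] k_def[symmetric])
    then show ?thesis
      using q' combination_scale by (metis insertE empty_iff zero_neq_one zero_neq_neg_one)
  qed
qed

text \<open>Over the complex numbers \<open>S\<close> has an isotropic vector on every plane, which
  reduces the claim to \<open>plane_isotropic\<close>.\<close>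

lemma plane_normal_form:
  assumes K: "K p q \<noteq> 0"
  shows "(S p p = 0 \<and> S p q = 0 \<and> S q q = 0) \<or>
    (\<exists>p' q'. combination p' p q \<and> combination q' p q \<and>
      (plane p' q' (- 1) 1 \<or> (\<exists>c. c \<notin> {1, - 1} \<and> plane p' q' c 0)))"
proof (cases "S p p = 0")
  case True
  then show ?thesis
    using plane_isotropic[OF K] by blast
next
  case False
  \<comment> \<open>\<open>t\<close> is a root of
    \<open>S p p * t * t + 2 * S p q * t + S q q\<close>, so \<open>u\<close> is isotropic. Its
    partner is \<open>- p\<close>, since then \<open>K u (- p) = K p q\<close>.\<close>
  define D where "D = csqrt (S p q * S p q - S p p * S q q)"
  have D: "D * D = S p q * S p q - S p p * S q q"
    by (simp add: D_def csqrt_squared)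
  define t where "t = (D - S p q) / S p p"
  define u where "u = q + t *s p"
  have "S u u = S q q + 2 * t * S p q + t * t * S p p"
    using S_commute[of q p] by (simp add: u_def SK algebra_simps)
  also have "\<dots> = (S p p * S q q + 2 * (D - S p q) * S p q + (D - S p q) * (D - S p q)) / S p p"
    using False by (simp add: t_def field_simps)
  also have "\<dots> = 0"
    using D by (simp add: algebra_simps)
  finally have Su: "S u u = 0" .
  have "K u (- p) = K p q"
    using K_commute[of q p] by (simp add: u_def SK)
  with K have Ku: "K u (- p) \<noteq> 0"
    by simp
  have u: "combination u p q"
    unfolding u_def combination_def by (intro exI[of _ t] exI[of _ 1]) simp
  have p: "combination (- p) p q"
    unfolding combination_def by (intro exI[of _ "- 1"] exI[of _ 0]) simp
  have "S (- p) (- p) \<noteq> 0"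
    using False by (simp add: SK)
  then obtain p' q' where "combination p' u (- p)" "combination q' u (- p)"
    "plane p' q' (- 1) 1 \<or> (\<exists>c. c \<notin> {1, - 1} \<and> plane p' q' c 0)"
    using plane_isotropic[OF Ku Su] by blast
  then show ?thesis
    using combination_trans[OF _ u p] by blast
qed

lemma combination_orthogonal:
  assumes "combination u p q" "combination v r t"
    and "B p r = 0" "B p t = 0" "B q r = 0" "B q t = 0"
    and "B r p = 0" "B t p = 0" "B r q = 0" "B t q = 0"
  shows "B u v = 0 \<and> B v u = 0"
  using assms by (auto simp: combination_def bilinear)

text \<open>The two planes are normalized separately. The last hypothesis excludes the alternating
  block from the first plane; the remaining combinations of blocks are tables 6 to 10, up to the
  order of the planes.\<close>

lemma realizable_two_planes:
  assumes K: "K p q \<noteq> 0" "K r t \<noteq> 0"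
    and orth: "B p r = 0" "B p t = 0" "B q r = 0" "B q t = 0"
      "B r p = 0" "B t p = 0" "B r q = 0" "B t q = 0"
    and S: "S p p \<noteq> 0 \<or> S p q \<noteq> 0"
  shows realizable
proof -
  obtain p' q' where c1: "combination p' p q" "combination q' p q"
    and p1: "plane p' q' (- 1) 1 \<or> (\<exists>c. c \<notin> {1, - 1} \<and> plane p' q' c 0)"
    using plane_normal_form[OF K(1)] S by blast
  have "\<exists>r' t'. combination r' r t \<and> combination t' r t \<and>
     (plane r' t' (- 1) 0 \<or> plane r' t' (- 1) 1 \<or> (\<exists>c. c \<notin> {1, - 1} \<and> plane r' t' c 0))"
  proof (cases "S r r = 0 \<and> S r t = 0 \<and> S t t = 0")
    case True
    then have "plane ((1 / K r t) *s r) t (- 1) 0"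
      using K S_commute[of t r] K_commute[of t r] by (simp add: plane_def B_eq SK)
    then show ?thesis
      using combination_scale combination_right by blast
  next
    case False
    then show ?thesis
      using plane_normal_form[OF K(2)] by blast
  qed
  then obtain r' t' where c2: "combination r' r t" "combination t' r t"
    and p2: "plane r' t' (- 1) 0 \<or> plane r' t' (- 1) 1 \<or> (\<exists>c. c \<notin> {1, - 1} \<and> plane r' t' c 0)"
    by blast
  have o: "B p' r' = 0" "B p' t' = 0" "B q' r' = 0" "B q' t' = 0"
      "B r' p' = 0" "B t' p' = 0" "B r' q' = 0" "B t' q' = 0"
    using combination_orthogonal[OF _ _ orth] c1 c2 by auto
  note simps = gram_Cons entry_def plane_def o
  from p1 show ?thesis
  proof (elim disjE exE conjE)
    assume 1: "plane p' q' (- 1) 1"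
    from p2 show ?thesis
    proof (elim disjE exE conjE)
      assume "plane r' t' (- 1) 0"
      with 1 show ?thesis
        by (intro realizableI[OF t6, of "[r', t', p', q']"]) (simp add: simps)
    next
      assume "plane r' t' (- 1) 1"
      with 1 show ?thesis
        by (intro realizableI[OF t8, of "[r', t', p', q']"]) (simp add: simps)
    next
      fix c assume "c \<notin> {1, - 1}" "plane r' t' c 0"
      with 1 show ?thesis
        by (intro realizableI[OF t9, of c "[p', q', r', t']"]) (simp_all add: simps)
    qed
  next
    fix c assume c: "c \<notin> {1, - 1}" and 1: "plane p' q' c 0"
    from p2 show ?thesis
    proof (elim disjE exE conjE)
      assume "plane r' t' (- 1) 0"
      with 1 c show ?thesis
        by (intro realizableI[OF t7, of c "[r', t', p', q']"]) (simp_all add: simps)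
    next
      assume "plane r' t' (- 1) 1"
      with 1 c show ?thesis
        by (intro realizableI[OF t9, of c "[r', t', p', q']"]) (simp_all add: simps)
    next
      fix d assume "d \<notin> {1, - 1}" "plane r' t' d 0"
      with 1 c show ?thesis
        by (intro realizableI[OF t10, of c d "[p', q', r', t']"]) (simp_all add: simps)
    qed
  qed
qed

text \<open>Symplectic Gram-Schmidt: extend \<open>e, f\<close> to a basis and subtract from the
  other two vectors their components along \<open>e\<close> and \<open>f\<close>.\<close>

lemma hyperbolic_pair_complement:
  assumes ef: "K e f = 1"
  obtains p q where "K e p = 0" "K f p = 0" "K e q = 0" "K f q = 0"
    "\<And>y. \<exists>a b c d. y = a *s e + b *s f + c *s p + d *s q"
    "\<And>c d. c *s p + d *s q = 0 \<Longrightarrow> c = 0 \<and> d = 0"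
proof -
  have "f \<noteq> 0"
    using ef by (auto simp: SK)
  have "e \<notin> vec.span {f}"
    using ef by (auto simp: vec.span_singleton SK)
  then have "e \<noteq> f"
    using vec.span_base[of f "{f}"] by auto
  have ind: "vec.independent {e, f}"
    using \<open>e \<notin> vec.span {f}\<close> \<open>f \<noteq> 0\<close> by (simp add: vec.independent_insert)
  obtain Bs where Bs: "{e, f} \<subseteq> Bs" "vec.independent Bs" "UNIV \<subseteq> vec.span Bs"
    using vec.maximal_independent_subset_extend[OF subset_UNIV ind] by metis
  have "card Bs = 4"
    using vec.basis_card_eq_dim[of Bs UNIV] Bs by (simp add: vec_dim_card del: vec.dim_UNIV)
  moreover have "finite Bs"
    using Bs(2) vec.finiteI_independent by blast
  ultimately have "card (Bs - {e, f}) = 2"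
    using Bs(1) \<open>e \<noteq> f\<close> by (simp add: card_Diff_subset)
  then obtain y z where yz: "Bs - {e, f} = {y, z}" "y \<noteq> z"
    by (auto simp: card_2_iff)
  then have Bs_eq: "Bs = {e, f, y, z}"
    using Bs(1) by blast
  have "y \<notin> {e, f, z}" "z \<notin> {e, f, y}"
    using yz by auto
  have y: "y \<notin> vec.span {e, f, z}"
  proof -
    have "Bs - {y} = {e, f, z}"
      using \<open>y \<notin> {e, f, z}\<close> Bs_eq by auto
    then show ?thesis
      using Bs(2) Bs_eq by (metis insertCI vec.dependent_def)
  qed
  have z: "z \<notin> vec.span {e, f, y}"
  proof -
    have "Bs - {z} = {e, f, y}"
      using \<open>z \<notin> {e, f, y}\<close> Bs_eq by auto
    then show ?thesis
      using Bs(2) Bs_eq by (metis insertCI vec.dependent_def)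
  qed
  define p where "p = y - K y f *s e - K e y *s f"
  define q where "q = z - K z f *s e - K e z *s f"
  have fe: "K f e = - 1"
    using ef K_commute[of f e] by simp
  show thesis
  proof
    show "K e p = 0" "K f p = 0" "K e q = 0" "K f q = 0"
      using ef fe K_commute[of f y] K_commute[of f z] by (simp_all add: p_def q_def SK)
    fix v
    have "v \<in> vec.span {e, f, y, z}"
      using Bs(3) Bs_eq by auto
    then obtain a b c d where "v - a *s e - b *s f - c *s y = d *s z"
      by (auto simp: vec.span_breakdown_eq)
    then have "v = a *s e + b *s f + c *s y + d *s z"
      by (simp add: algebra_simps)
    also have "\<dots> = (a + c * K y f + d * K z f) *s e + (b + c * K e y + d * K e z) *s f + c *s p + d *s q"
      by (simp add: p_def q_def vec.scale_left_distrib vec.scale_right_diff_distrib)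
    finally show "\<exists>a b c d. v = a *s e + b *s f + c *s p + d *s q"
      by blast
  next
    fix c d
    assume 0: "c *s p + d *s q = 0"
    define a where "a = c * K y f + d * K z f"
    define b where "b = c * K e y + d * K e z"
    have eq: "c *s y + d *s z = a *s e + b *s f"
      using 0 by (simp add: p_def q_def a_def b_def vec.scale_left_distrib
        vec.scale_right_diff_distrib algebra_simps)
    have "c = 0"
    proof (rule ccontr)
      assume "c \<noteq> 0"
      then have "y = (1 / c) *s (c *s y)"
        by simp
      also have "c *s y = a *s e + b *s f - d *s z"
        using eq by (simp add: algebra_simps)
      finally have "y \<in> vec.span {e, f, z}"
        by (metis insertCI vec.span_add vec.span_base vec.span_diff vec.span_scale)
      with y show False ..
    qed
    moreover have "d = 0"
    proof (rule ccontr)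
      assume "d \<noteq> 0"
      then have "z = (1 / d) *s (d *s z)"
        by simp
      also have "d *s z = a *s e + b *s f - c *s y"
        using eq by (simp add: algebra_simps)
      finally have "z \<in> vec.span {e, f, y}"
        by (metis insertCI vec.span_add vec.span_base vec.span_diff vec.span_scale)
      with z show False ..
    qed
    ultimately show "c = 0 \<and> d = 0" ..
  qed
qed

subsection \<open>Symmetric forms\<close>

lemma S_sum_left: "S (\<Sum>x\<in>F. g x) w = (\<Sum>x\<in>F. S (g x) w)"
  by (induction F rule: infinite_finite_induct) (auto simp: SK)

text \<open>Fewer than four vectors do not span, so some vector has a nonzero projection to their
  orthogonal complement. Nondegeneracy keeps \<open>S\<close> from vanishing there, and a
  nonisotropic vector is scaled to length one.\<close>

lemma extend_orthonormal:
  assumes F: "finite F" "card F < 4" "\<And>x y. x \<in> F \<Longrightarrow> y \<in> F \<Longrightarrow> S x y = (if x = y then 1 else 0)"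
    and nondeg: "\<And>u. (\<And>v. S u v = 0) \<Longrightarrow> u = 0"
  obtains y where "S y y = 1" "\<And>x. x \<in> F \<Longrightarrow> S x y = 0"
proof -
  define proj where "proj v = v - (\<Sum>x\<in>F. S v x *s x)" for v
  have proj: "S (proj v) x = 0" if "x \<in> F" for v x
  proof -
    have "S (proj v) x = S v x - (\<Sum>y\<in>F. S v y * S y x)"
      by (simp add: proj_def S_sum_left SK)
    also have "(\<Sum>y\<in>F. S v y * S y x) = (\<Sum>y\<in>F. if y = x then S v x else 0)"
      using F(3) that by (intro sum.cong) auto
    finally show ?thesis
      using F(1) that by simp
  qed
  obtain y where "y \<notin> vec.span F"
    using exists_outside_span[OF F(1,2)] by blast
  moreover have "(\<Sum>x\<in>F. S y x *s x) \<in> vec.span F"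
    by (intro vec.span_sum vec.span_scale vec.span_base)
  ultimately have "proj y \<noteq> 0"
    by (auto simp: proj_def)
  then obtain v where v: "S (proj y) v \<noteq> 0"
    using nondeg by blast
  \<comment> \<open>\<open>v\<close> and \<open>proj v\<close> differ by a vector orthogonal to
    \<open>proj y\<close>, so \<open>v\<close> can be replaced by \<open>proj v\<close>.\<close>
  have "S (\<Sum>x\<in>F. S v x *s x) (proj y) = (\<Sum>x\<in>F. S v x * S x (proj y))"
    by (simp add: S_sum_left SK)
  also have "\<dots> = 0"
    using proj S_commute by (intro sum.neutral ballI) (metis mult_zero_right)
  finally have yv: "S (proj y) (proj v) \<noteq> 0"
    using v S_commute[of "proj y"] by (simp add: proj_def[of v] SK)
  \<comment> \<open>Polarization: if all vectors orthogonal to \<open>F\<close> were isotropic,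
    \<open>S\<close> would vanish on every pair of them.\<close>
  have "\<exists>w. S w w \<noteq> 0 \<and> (\<forall>x\<in>F. S w x = 0)"
  proof (rule ccontr)
    assume "\<not> ?thesis"
    then have *: "S w w = 0" if "\<forall>x\<in>F. S w x = 0" for w
      using that by blast
    have "S (proj y + proj v) (proj y + proj v) = 0" "S (proj y) (proj y) = 0" "S (proj v) (proj v) = 0"
      by (rule *; simp add: proj S_bilinear(1))+
    then show False
      using yv S_commute[of "proj v" "proj y"] by (simp add: SK)
  qed
  then obtain w where w: "S w w \<noteq> 0" "\<And>x. x \<in> F \<Longrightarrow> S x w = 0"
    using S_commute by metis
  have "S ((1 / csqrt (S w w)) *s w) ((1 / csqrt (S w w)) *s w) = S w w / (csqrt (S w w) * csqrt (S w w))"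
    by (simp add: SK)
  with w show thesis
    by (intro that[of "(1 / csqrt (S w w)) *s w"]) (simp_all add: SK csqrt_squared)
qed

lemma realizable_symmetric:
  assumes K0: "\<And>u v. K u v = 0"
    and nondeg: "\<And>u. (\<And>v. S u v = 0) \<Longrightarrow> u = 0"
  shows realizable
proof -
  obtain a where a: "S a a = 1"
    using extend_orthonormal[OF _ _ _ nondeg, of "{}"] by auto
  obtain b where b: "S b b = 1" "S a b = 0"
    using extend_orthonormal[OF _ _ _ nondeg, of "{a}"] a by auto
  then have b': "S b a = 0" "a \<noteq> b"
    using a S_commute[of b a] by auto
  obtain c where c: "S c c = 1" "S a c = 0" "S b c = 0"
    by (rule extend_orthonormal[OF _ _ _ nondeg, of "{a, b}"]) (use a b b' in auto)
  then have c': "S c a = 0" "S c b = 0" "a \<noteq> c" "b \<noteq> c"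
    using a b S_commute[of c a] S_commute[of c b] by auto
  obtain d where d: "S d d = 1" "S a d = 0" "S b d = 0" "S c d = 0"
    by (rule extend_orthonormal[OF _ _ _ nondeg, of "{a, b, c}"]) (use a b b' c c' in auto)
  then have d': "S d a = 0" "S d b = 0" "S d c = 0"
    using S_commute[of d a] S_commute[of d b] S_commute[of d c] by simp_all
  show ?thesis
    using a b b' c c' d d' by (intro realizableI[OF t14, of "[a, b, c, d]"]) (simp add: gram_Cons entry_def B_eq K0)
qed

section \<open>Restriction of \<open>S\<close> to a plane\<close>

lemma symmetric_pair_aux:
  assumes ind: "indep p q" and p: "S p p \<noteq> 0"
  shows "\<exists>p' q'. combination p' p q \<and> combination q' p q \<and> S p' p' = 1 \<and> S p' q' = 0 \<and>
    (S q' q' = 1 \<or> q' \<noteq> 0 \<and> S q' p = 0 \<and> S q' q = 0)"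
proof -
  \<comment> \<open>\<open>D\<close> is the Gram determinant and \<open>r\<close> the part of
    \<open>q\<close> orthogonal to \<open>p\<close>, cleared of denominators. As
    \<open>S r r = S p p * D\<close>, either \<open>r\<close> can be normalized or it lies in the
    radical of \<open>S\<close> on the plane.\<close>
  define D where "D = S p p * S q q - S p q * S p q"
  define r where "r = (- S p q) *s p + S p p *s q"
  have qp: "S q p = S p q"
    by (rule S_commute)
  have r: "combination r p q" "r \<noteq> 0" "S r p = 0" "S p r = 0" "S r q = D" "S r r = S p p * D"
  proof -
    show "combination r p q"
      unfolding r_def by (rule combinationI)
    show "r \<noteq> 0"
      using ind p unfolding r_def indep_def by blast
    show "S r p = 0" "S p r = 0" "S r q = D" "S r r = S p p * D"
      by (simp_all add: r_def SK qp D_def algebra_simps)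
  qed
  define s where "s = csqrt (S p p)"
  have s: "s * s = S p p" "s \<noteq> 0"
    using p by (auto simp: s_def csqrt_squared)
  define p' where "p' = (1 / s) *s p"
  have p': "combination p' p q" "S p' p' = 1" "S p' r = 0"
    using s r combination_scale by (auto simp: p'_def SK field_simps)
  show ?thesis
  proof (cases "D = 0")
    case True
    with p' r show ?thesis
      by blast
  next
    case False
    define t where "t = csqrt (S r r)"
    have t: "t * t = S r r" "t \<noteq> 0"
      using p False r by (auto simp: t_def csqrt_squared)
    define q' where "q' = (1 / t) *s r"
    have "combination q' p q"
      unfolding q'_def using combination_trans[OF combination_scale(1) r(1) r(1)] .
    moreover have "S q' q' = 1" "S p' q' = 0"
      using t p' by (auto simp: q'_def SK field_simps)
    ultimately show ?thesis
      using p' by blast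
  qed
qed

text \<open>The alternatives are the ranks zero, two and one of \<open>S\<close> on the plane; in
  the last one \<open>q'\<close> spans the radical.\<close>

lemma symmetric_pair:
  assumes ind: "indep p q"
  shows "S p p = 0 \<and> S p q = 0 \<and> S q q = 0 \<or>
    (\<exists>p' q'. combination p' p q \<and> combination q' p q \<and> S p' p' = 1 \<and> S p' q' = 0 \<and>
    (S q' q' = 1 \<or> q' \<noteq> 0 \<and> S q' p = 0 \<and> S q' q = 0))"
proof -
  consider "S p p \<noteq> 0" | "S q q \<noteq> 0" | "S p p = 0" "S q q = 0" "S p q \<noteq> 0" | "S p p = 0" "S p q = 0" "S q q = 0"
    by blast
  then show ?thesis
  proof cases
    case 1
    then show ?thesis
      using symmetric_pair_aux[OF ind] by blast
  next
    case 2
    then show ?thesis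
      using symmetric_pair_aux[of q p] ind indep_commute combination_commute by blast
  next
    case 3
    \<comment> \<open>Two isotropic vectors with \<open>S p q \<noteq> 0\<close> have a nonisotropic
      sum, which takes over the role of \<open>p\<close>.\<close>
    have ind': "indep (p + q) q"
      unfolding indep_def
    proof (intro allI impI)
      fix c d
      assume "c *s (p + q) + d *s q = 0"
      then have "c *s p + (c + d) *s q = 0"
        by (simp add: vec.scale_right_distrib vec.scale_left_distrib add.assoc)
      then have "c = 0 \<and> c + d = 0"
        using ind unfolding indep_def by blast
      then show "c = 0 \<and> d = 0"
        by auto
    qed
    have pq: "combination (p + q) p q"
      unfolding combination_def by (intro exI[of _ 1]) simp
    have "S (p + q) (p + q) \<noteq> 0"
      using 3 S_commute[of q p] by (simp add: SK)
    from symmetric_pair_aux[OF ind' this] obtain p' q' where *: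
      "combination p' (p + q) q" "combination q' (p + q) q" "S p' p' = 1" "S p' q' = 0"
      "S q' q' = 1 \<or> q' \<noteq> 0 \<and> S q' (p + q) = 0 \<and> S q' q = 0"
      by blast
    then have "combination p' p q" "combination q' p q"
      using combination_trans[OF _ pq combination_right] by blast+
    moreover have "S q' q' = 1 \<or> q' \<noteq> 0 \<and> S q' p = 0 \<and> S q' q = 0"
      using *(5) by (auto simp: SK)
    ultimately show ?thesis
      using * by blast
  qed blast
qed

subsection \<open>Skew part of rank two\<close>

text \<open>Vectors \<open>y\<close> and \<open>r\<close> are built such that \<open>S\<close> pairs
  \<open>q\<close> with \<open>y\<close> and \<open>K\<close> pairs \<open>r\<close> with
  \<open>y\<close>. The only invariant left is whether \<open>S r r\<close> vanishes: it decides
  between tables 4 and 5.\<close>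

lemma realizable_kernel_rank_one:
  assumes ker: "\<And>v. K p v = 0" "\<And>v. K q v = 0"
    and S: "S p p = 1" "S p q = 0" "S q q = 0" "S q f \<noteq> 0"
    and ef: "K e f \<noteq> 0"
  shows realizable
proof -
  have ker': "K v p = 0" "K v q = 0" for v
    using ker K_commute[of v] by auto
  note ker = ker ker'
  \<comment> \<open>\<open>f\<close> loses its component along \<open>p\<close>, is scaled against
    \<open>q\<close>, and is then made isotropic by a multiple of \<open>q\<close>. Adding kernel
    vectors does not affect \<open>K\<close>.\<close>
  define f1 where "f1 = (1 / S q f) *s (f - S f p *s p)"
  have f1: "S q f1 = 1" "S f1 p = 0" "K e f1 = K e f / S q f"
    using S S_commute[of q p] by (simp_all add: f1_def SK ker)
  define y where "y = f1 - (S f1 f1 / 2) *s q"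
  have y: "S q y = 1" "S y p = 0" "K e y = K e f / S q f" "S y y = 0"
    using f1 S S_commute[of q p] S_commute[of f1 q] by (simp_all add: y_def SK ker)
  have pS: "S p y = 0" "S y q = 1" "S q p = 0"
    using y S S_commute[of p y] S_commute[of y q] S_commute[of q p] by auto
  \<comment> \<open>\<open>e\<close> is made orthogonal to \<open>p\<close> and \<open>q\<close>;
    removing a multiple of \<open>y\<close> does not change \<open>K e y\<close>.\<close>
  define r0 where "r0 = e - S e p *s p - S e q *s y"
  have r0: "S r0 p = 0" "S r0 q = 0" "K r0 y = K e f / S q f"
    using y S pS by (simp_all add: r0_def SK ker)
  define k where "k = K e f / S q f"
  have k: "k \<noteq> 0"
    using S ef by (simp add: k_def)
  define r where "r = (1 / k) *s (r0 - S r0 y *s q)"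
  have r: "S r p = 0" "S r q = 0" "S r y = 0" "K r y = 1"
    using r0 S y pS k by (simp_all add: r_def SK ker k_def)
  then have r': "S p r = 0" "S q r = 0" "S y r = 0" "K y r = - 1"
    using S_commute[of r] K_commute[of y r] by auto
  note facts = S y pS r r' ker
  show ?thesis
  proof (cases "S r r = 0")
    case True
    \<comment> \<open>Half sum and half difference separate the two sides:
      \<open>B ?x1 y = 1 = B y ?x2\<close>, whereas \<open>B y ?x1\<close> and
      \<open>B ?x2 y\<close> vanish.\<close>
    let ?x1 = "(1 / 2) *s (q + r)" and ?x2 = "(1 / 2) *s (q - r)"
    show ?thesis
      using facts True
      by (intro realizableI[OF t4, of "[?x1, ?x2, y, p]"])
        (simp add: gram_Cons entry_def B_eq SK)
  next
    case False
    define s where "s = csqrt (S r r)"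
    have s: "s * s = S r r" "s \<noteq> 0"
      using False by (auto simp: s_def csqrt_squared)
    let ?x1 = "(1 / s) *s q" and ?x2 = "(1 / s) *s r" and ?x3 = "s *s y"
    show ?thesis
      using facts s False
      by (intro realizableI[OF t5, of "[?x1, ?x2, ?x3, p]"])
        (simp add: gram_Cons entry_def B_eq SK field_simps)
  qed
qed

text \<open>The determinant says that \<open>S\<close> pairs the span of \<open>p, q\<close>
  perfectly with that of \<open>e, f\<close>. Kernel corrections then make \<open>S\<close> vanish
  on the span of \<open>e, f\<close> without touching \<open>K\<close>, and table 2 remains.\<close>

lemma realizable_kernel_isotropic:
  assumes ker: "\<And>v. K p v = 0" "\<And>v. K q v = 0"
    and S: "S p p = 0" "S p q = 0" "S q q = 0" "S p e * S q f - S p f * S q e \<noteq> 0"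
    and ef: "K e f = 1"
  shows realizable
proof -
  have ker': "K v p = 0" "K v q = 0" for v
    using ker K_commute[of v] by auto
  note ker = ker ker'
  have qp: "S q p = 0" "K f e = - 1"
    using S S_commute[of q p] ef K_commute[of f e] by auto
  define D where "D = S p e * S q f - S p f * S q e"
  have D: "D \<noteq> 0"
    using S by (simp add: D_def)
  \<comment> \<open>Cramer's rule for the basis dual to \<open>e, f\<close> with respect to
    \<open>S\<close>.\<close>
  define P where "P = (1 / D) *s (S q f *s p - S p f *s q)"
  define Q where "Q = (1 / D) *s (S p e *s q - S q e *s p)"
  have PQ: "S P P = 0" "S P Q = 0" "S Q P = 0" "S Q Q = 0"
      "\<And>v. K P v = 0" "\<And>v. K Q v = 0" "\<And>v. K v P = 0" "\<And>v. K v Q = 0"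
    using S qp by (simp_all add: P_def Q_def SK ker)
  have "S q f * S p e - S p f * S q e = D" "S p e * S q f - S q e * S p f = D"
    by (simp_all add: D_def mult.commute)
  moreover have "S P e = (1 / D) * (S q f * S p e - S p f * S q e)"
    "S Q f = (1 / D) * (S p e * S q f - S q e * S p f)"
    by (simp_all only: P_def Q_def SK)
  moreover have "S P f = 0" "S Q e = 0"
    by (simp_all add: P_def Q_def SK algebra_simps)
  ultimately have PQ': "S P e = 1" "S Q f = 1" "S P f = 0" "S Q e = 0"
      "S e P = 1" "S f Q = 1" "S f P = 0" "S e Q = 0"
    using D S_commute[of e] S_commute[of f] by auto
  \<comment> \<open>The multiple of \<open>Q\<close> in \<open>e'\<close> cancels
    \<open>S e f\<close>; the halved terms cancel \<open>S e e\<close> and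
    \<open>S f f\<close>.\<close>
  define e' where "e' = e - (S e e / 2) *s P - S e f *s Q"
  define f' where "f' = f - (S f f / 2) *s Q"
  have "S e' e' = 0" "S f' f' = 0" "S e' f' = 0" "S f' e' = 0" "K e' f' = 1" "K f' e' = - 1"
      "S P e' = 1" "S Q f' = 1" "S P f' = 0" "S Q e' = 0"
      "S e' P = 1" "S f' Q = 1" "S f' P = 0" "S e' Q = 0"
    using PQ PQ' ef qp S_commute[of f e] by (simp_all add: e'_def f'_def SK)
  with PQ show ?thesis
    by (intro realizableI[OF t2, of "[Q, e', P, f']"]) (simp add: gram_Cons entry_def B_eq)
qed

text \<open>The plane of \<open>p, q\<close> splits off orthogonally, and removing components in the
  kernel leaves \<open>K\<close> unchanged. The normal forms of the complementary plane give tables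
  11 to 13.\<close>

lemma realizable_kernel_orthonormal:
  assumes ker: "\<And>v. K p v = 0" "\<And>v. K q v = 0"
    and S: "S p p = 1" "S p q = 0" "S q q = 1"
    and ef: "K e f = 1"
  shows realizable
proof -
  have ker': "K v p = 0" "K v q = 0" for v
    using ker K_commute[of v] by auto
  note ker = ker ker'
  have qp: "S q p = 0"
    using S S_commute[of q p] by simp
  define e' where "e' = e - S e p *s p - S e q *s q"
  define f' where "f' = f - S f p *s p - S f q *s q"
  have K: "K e' f' = 1"
    using ef by (simp add: e'_def f'_def SK ker)
  have "S e' p = 0" "S e' q = 0" "S f' p = 0" "S f' q = 0"
    using S qp by (simp_all add: e'_def f'_def SK)
  then have o: "B e' p = 0" "B e' q = 0" "B f' p = 0" "B f' q = 0"
      "B p e' = 0" "B q e' = 0" "B p f' = 0" "B q f' = 0"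
    using S_commute[of p] S_commute[of q] by (auto simp: B_eq ker)
  have pq: "B p p = 1" "B p q = 0" "B q p = 0" "B q q = 1"
    using S qp by (auto simp: B_eq ker)
  have "plane e' f' (- 1) 0 \<or> (\<exists>p' q'. combination p' e' f' \<and> combination q' e' f' \<and>
      (plane p' q' (- 1) 1 \<or> (\<exists>c. c \<notin> {1, - 1} \<and> plane p' q' c 0)))"
    using plane_normal_form[of e' f'] K S_commute[of f' e'] K_commute[of f' e']
    by (auto simp: plane_def B_eq)
  then obtain x y where xy: "combination x e' f'" "combination y e' f'"
    and cases: "plane x y (- 1) 0 \<or> plane x y (- 1) 1 \<or> (\<exists>c. c \<notin> {1, - 1} \<and> plane x y c 0)"
    using combination_left combination_right by metis
  have "B x p = 0" "B x q = 0" "B y p = 0" "B y q = 0" "B p x = 0" "B q x = 0" "B p y = 0" "B q y = 0"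
    using combination_orthogonal[OF _ _ o] xy combination_left[of p q] combination_right[of q p]
    by auto
  note simps = gram_Cons entry_def plane_def this pq
  from cases show ?thesis
  proof (elim disjE exE conjE)
    assume "plane x y (- 1) 0"
    then show ?thesis
      by (intro realizableI[OF t11, of "[x, y, p, q]"]) (simp add: simps)
  next
    assume "plane x y (- 1) 1"
    then show ?thesis
      by (intro realizableI[OF t12, of "[x, y, p, q]"]) (simp add: simps)
  next
    fix c assume "c \<notin> {1, - 1}" "plane x y c 0"
    then show ?thesis
      by (intro realizableI[OF t13, of c "[x, y, p, q]"]) (simp_all add: simps)
  qed
qed

text \<open>\<open>p\<close> and \<open>q\<close> span the kernel of \<open>K\<close>, and the rank
  of \<open>S\<close> on it decides which of the three preceding constructions applies.\<close>

lemma realizable_skew_rank_two: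
  assumes nondeg: "\<And>u. (\<And>v. B u v = 0 \<and> B v u = 0) \<Longrightarrow> u = 0"
    and ef: "K e f = 1"
    and ker: "\<And>v. K p v = 0" "\<And>v. K q v = 0"
    and spans: "\<And>y. \<exists>a b c d. y = a *s e + b *s f + c *s p + d *s q"
    and ind: "indep p q"
  shows realizable
proof -
  have ker': "K v p = 0" "K v q = 0" for v
    using ker K_commute[of v] by auto
  have fe: "K f e = - 1"
    using ef K_commute[of f e] by simp
  have radical: "u = 0" if u: "combination u p q" and "S u p = 0" "S u q = 0" "S u e = 0" "S u f = 0" for u
  proof (rule nondeg)
    fix v
    have "K u v = 0" "K v u = 0"
      using u by (auto simp: combination_def SK ker ker')
    moreover have "S u v = 0"
      using spans[of v] that by (auto simp: SK)
    ultimately show "B u v = 0 \<and> B v u = 0"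
      using S_commute[of v u] by (simp add: B_eq)
  qed
  from symmetric_pair[OF ind] show ?thesis
  proof (elim disjE exE conjE)
    assume S0: "S p p = 0" "S p q = 0" "S q q = 0"
    then have S1: "S q p = 0"
      using S_commute[of q p] by simp
    have "S p e * S q f - S p f * S q e \<noteq> 0"
    proof
      assume D: "S p e * S q f - S p f * S q e = 0"
      have eqD: "S p f * S q e = S p e * S q f"
        using D by simp
      \<comment> \<open>With vanishing determinant these two combinations are orthogonal to
        \<open>e\<close> and \<open>f\<close>, hence lie in the radical; their zero coefficients
        then put \<open>p\<close> itself there.\<close>
      have 0: "(- S q e) *s p + S p e *s q = 0" "(- S q f) *s p + S p f *s q = 0"
        by (rule radical[OF combinationI]; simp add: SK S0 S1 eqD algebra_simps)+
      then have "S p e = 0" "S p f = 0"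
        using ind unfolding indep_def by blast+
      then have "p = 0"
        using S0 by (auto intro!: radical combination_left)
      then have "1 *s p + 0 *s q = 0"
        by simp
      then show False
        using ind unfolding indep_def by (metis zero_neq_one)
    qed
    then show ?thesis
      using realizable_kernel_isotropic[OF ker] S0 ef by blast
  next
    fix p' q'
    assume *: "combination p' p q" "combination q' p q" "S p' p' = 1" "S p' q' = 0" "S q' q' = 1"
    then have "K p' v = 0" "K q' v = 0" for v
      by (auto simp: combination_def SK ker)
    then show ?thesis
      using realizable_kernel_orthonormal * ef by blast
  next
    fix p' q'
    assume *: "combination p' p q" "combination q' p q" "S p' p' = 1" "S p' q' = 0"
      "q' \<noteq> 0" "S q' p = 0" "S q' q = 0"
    then have ker'': "K p' v = 0" "K q' v = 0" for v
      by (auto simp: combination_def SK ker)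
    have "S q' q' = 0"
    proof -
      obtain a b where "q' = a *s p + b *s q"
        using *(2) combination_def by blast
      then have "S q' q' = a * S q' p + b * S q' q"
        by (metis S_bilinear(2) S_bilinear(4))
      then show ?thesis
        using * by simp
    qed
    \<comment> \<open>\<open>q'\<close> is orthogonal to the whole kernel, so only \<open>e\<close>
      or \<open>f\<close> can keep it out of the radical.\<close>
    moreover have "S q' e \<noteq> 0 \<or> S q' f \<noteq> 0"
      using radical * by blast
    ultimately show ?thesis
      using realizable_kernel_rank_one[OF ker'', of f e] realizable_kernel_rank_one[OF ker'', of e f]
        ef fe *(3,4) by auto
  qed
qed

end

subsection \<open>Nondegenerate skew part\<close>

text \<open>\<open>X\<close> lies in the symplectic Lie algebra of \<open>K\<close>, and
  \<open>K\<close> and \<open>X\<close> determine \<open>B\<close>. Classifying \<open>B\<close>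
  amounts to finding normal forms of \<open>X\<close> under the symplectic group.\<close>

locale skew_nondegenerate = bilinear_form +
  fixes X :: "complex^4 \<Rightarrow> complex^4"
  assumes K_X: "K (X u) v = S u v"
    and K_nondegenerate: "(\<And>v. K u v = 0) \<Longrightarrow> u = 0"
begin

lemma K_eqI: "(\<And>v. K u v = K w v) \<Longrightarrow> u = w"
  using K_nondegenerate[of "u - w"] by (simp add: SK)

lemma X_add: "X (u + v) = X u + X v"
  by (rule K_eqI) (simp add: SK K_X)

lemma X_scale: "X (c *s u) = c *s X u"
  by (rule K_eqI) (simp add: SK K_X)

lemma X_zero: "X 0 = 0"
  by (rule K_eqI) (simp add: SK K_X)

lemma X_diff: "X (u - v) = X u - X v"
  by (rule K_eqI) (simp add: SK K_X)

lemma K_X_right: "K u (X v) = - S u v"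
  using K_commute[of u "X v"] K_X[of v u] S_commute[of v u] by simp

lemma K_X_shift: "K (X u) v = - K u (X v)"
  by (simp add: K_X K_X_right)

subsection \<open>Eigenvectors\<close>

text \<open>The vector \<open>p(X) v\<close>, by Horner's scheme.\<close>

definition apply_poly :: "complex poly \<Rightarrow> complex^4 \<Rightarrow> complex^4" where
  "apply_poly p v = fold_coeffs (\<lambda>a w. a *s v + X w) p 0"

lemma apply_poly_0: "apply_poly 0 v = 0"
  by (simp add: apply_poly_def)

lemma apply_poly_pCons: "apply_poly (pCons a p) v = a *s v + X (apply_poly p v)"
  by (cases "p = 0 \<and> a = 0") (auto simp: apply_poly_def X_zero)

lemma apply_poly_add: "apply_poly (p + q) v = apply_poly p v + apply_poly q v"
  by (induction p q rule: poly_induct2)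
    (simp_all add: apply_poly_0 apply_poly_pCons X_add vec.scale_left_distrib)

lemma apply_poly_smult: "apply_poly (smult c p) v = c *s apply_poly p v"
  by (induction p) (simp_all add: apply_poly_0 apply_poly_pCons X_scale vec.scale_right_distrib)

text \<open>\<open>X\<close> commutes with every polynomial in \<open>X\<close>, so the linear
  factor may be applied first.\<close>

lemma apply_poly_linear_factor: "apply_poly ([:- l, 1:] * q) v = apply_poly q (X v - l *s v)"
proof -
  have "apply_poly q (X v - l *s v) = X (apply_poly q v) - l *s apply_poly q v"
  proof (induction q)
    case (pCons a q)
    have "a *s (X v - l *s v) = a *s X v - l *s (a *s v)"
      by (simp add: vec.scale_right_diff_distrib mult.commute)
    with pCons show ?case
      by (simp add: apply_poly_pCons X_add X_scale X_diff vec.scale_right_distrib)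
  qed (simp add: apply_poly_0 X_zero)
  then show ?thesis
    by (simp add: apply_poly_add apply_poly_smult apply_poly_pCons mult_pCons_left algebra_simps
        flip: smult_minus_left)
qed

lemma apply_poly_monom: "apply_poly (monom c i) v = c *s (X ^^ i) v"
  by (induction i) (simp_all add: monom_0 monom_Suc apply_poly_0 apply_poly_pCons X_zero X_scale)

lemma apply_poly_sum: "finite I \<Longrightarrow> apply_poly (\<Sum>i\<in>I. f i) v = (\<Sum>i\<in>I. apply_poly (f i) v)"
  by (induction I rule: finite_induct) (simp_all add: apply_poly_0 apply_poly_add)

text \<open>Induction on the degree, splitting off a root \<open>l\<close>. If the cofactor yields
  no eigenvector, then \<open>X - l\<close> kills \<open>(X ^^ n) v\<close>, which is an eigenvector
  for \<open>l \<noteq> 0\<close> or is killed by \<open>X\<close>.\<close>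

lemma annihilated_cases:
  assumes "p \<noteq> 0" "apply_poly p v = 0"
  shows "(\<exists>l u. l \<noteq> 0 \<and> u \<noteq> 0 \<and> X u = l *s u) \<or> (X ^^ degree p) v = 0"
  using assms
proof (induction "degree p" arbitrary: p v)
  case 0
  then obtain a where "p = [:a:]"
    by (metis degree_eq_zeroE)
  with 0 show ?case
    by (auto simp: apply_poly_pCons apply_poly_0 X_zero)
next
  case (Suc n)
  have "\<not> constant (poly p)"
    using Suc(2) by (simp add: constant_degree)
  then obtain l where "poly p l = 0"
    using fundamental_theorem_of_algebra by blast
  then obtain q where q: "p = [:- l, 1:] * q"
    using poly_eq_0_iff_dvd by (metis dvdE)
  then have "q \<noteq> 0"
    using Suc by auto
  then have deg: "degree q = n"
    using Suc(2) q degree_mult_eq[of "[:- l, 1:]" q] by simp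
  have "apply_poly q (X v - l *s v) = 0"
    using Suc(4) q apply_poly_linear_factor by metis
  then consider "\<exists>l u. l \<noteq> 0 \<and> u \<noteq> 0 \<and> X u = l *s u" | "(X ^^ n) (X v - l *s v) = 0"
    using Suc(1)[of q] deg \<open>q \<noteq> 0\<close> by blast
  then show ?case
  proof cases
    case 2
    have "(X ^^ n) (X v - l *s v) = X ((X ^^ n) v) - l *s (X ^^ n) v" for n
      by (induction n) (simp_all add: X_diff X_scale)
    with 2 have "X ((X ^^ n) v) = l *s (X ^^ n) v"
      by simp
    moreover have "degree p = Suc n"
      using Suc(2) by simp
    moreover have "l = 0 \<or> (X ^^ n) v = 0 \<Longrightarrow> X ((X ^^ n) v) = 0"
      using \<open>X ((X ^^ n) v) = l *s (X ^^ n) v\<close> by auto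
    ultimately show ?thesis
      by (metis funpow.simps(2) o_apply)
  qed blast
qed

text \<open>The vectors \<open>(X ^^ i) v\<close> for \<open>i\<close> up to 4 are dependent, which
  gives an annihilating polynomial of degree at most 4.\<close>

lemma nonzero_eigenvalue_or_nilpotent:
  "(\<exists>l u. l \<noteq> 0 \<and> u \<noteq> 0 \<and> X u = l *s u) \<or> (\<forall>v. X (X (X (X v))) = 0)"
proof (rule disjCI)
  assume no: "\<not> (\<forall>v. X (X (X (X v))) = 0)"
  then obtain v where v: "X (X (X (X v))) \<noteq> 0"
    by blast
  obtain a where a: "\<exists>i\<le>4. a i \<noteq> 0" "(\<Sum>i\<le>4. a i *s (X ^^ i) v) = 0"
    using five_vectors_dependent[of "\<lambda>i. (X ^^ i) v"] by blast
  define p where "p = (\<Sum>i\<le>4. monom (a i) i)"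
  have "coeff p i = a i" if "i \<le> 4" for i
    using that by (simp add: p_def coeff_sum)
  then have "p \<noteq> 0"
    using a(1) by (metis coeff_0)
  moreover have "apply_poly p v = 0"
    using a(2) by (simp add: p_def apply_poly_sum apply_poly_monom)
  moreover have "(X ^^ degree p) v \<noteq> 0"
  proof
    assume 0: "(X ^^ degree p) v = 0"
    have "degree p \<le> 4"
      unfolding p_def by (intro degree_sum_le) (auto intro: order_trans[OF degree_monom_le])
    then have "(X ^^ 4) v = (X ^^ (4 - degree p)) ((X ^^ degree p) v)"
      by (metis add.commute funpow_add le_add_diff_inverse o_apply)
    also have "(X ^^ n) 0 = 0" for n
      by (induction n) (simp_all add: X_zero)
    then have "(X ^^ (4 - degree p)) ((X ^^ degree p) v) = 0"
      by (simp only: 0)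
    finally show False
      using v by (simp add: eval_nat_numeral)
  qed
  ultimately show "\<exists>l u. l \<noteq> 0 \<and> u \<noteq> 0 \<and> X u = l *s u"
    using annihilated_cases by blast
qed

text \<open>By skewness the image of \<open>X + l\<close> is \<open>K\<close>-orthogonal to
  \<open>u\<close>, so \<open>X + l\<close> is not surjective and, in finite dimension, not
  injective.\<close>

lemma negative_eigenvector:
  assumes "X u = l *s u" "u \<noteq> 0"
  shows "\<exists>v. v \<noteq> 0 \<and> X v = (- l) *s v"
proof (rule ccontr)
  assume no: "\<not> ?thesis"
  define g where "g v = X v + l *s v" for v
  have lin: "Vector_Spaces.linear (*s) (*s) g"
    unfolding Vector_Spaces.linear_iff
    by (auto simp: g_def X_add X_scale vec.scale_right_distrib algebra_simps vec.vector_space_axioms)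
  have "inj g"
  proof (rule injI)
    fix v w
    assume "g v = g w"
    then have "X (v - w) = (- l) *s (v - w)"
      by (simp add: g_def X_diff vec.scale_right_diff_distrib algebra_simps)
    then have "v - w = 0"
      using no by blast
    then show "v = w"
      by simp
  qed
  then have "surj g"
    using vec.linear_inj_imp_surj[OF lin] by blast
  have "K u (g y) = 0" for y
    using K_X_shift[of u y] assms(1) by (simp add: g_def SK)
  then have "K u v = 0" for v
    using \<open>surj g\<close> by (metis surjD)
  then show False
    using K_nondegenerate assms(2) by blast
qed

text \<open>Otherwise the functional \<open>K u\<close> vanishes on the kernel of
  \<open>K v\<close>, so it is a multiple of \<open>K v\<close>, and nondegeneracy makes
  \<open>u\<close> the same multiple of \<open>v\<close>.\<close>

lemma dual_vector:
  assumes "\<And>c. u \<noteq> c *s v"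
  shows "\<exists>w. K u w = 1 \<and> K v w = 0"
proof (rule ccontr)
  assume no: "\<not> ?thesis"
  have *: "K u w = 0" if "K v w = 0" for w
  proof (rule ccontr)
    assume "K u w \<noteq> 0"
    then have "K u ((1 / K u w) *s w) = 1 \<and> K v ((1 / K u w) *s w) = 0"
      using that by (simp add: SK)
    with no show False
      by blast
  qed
  have "v \<noteq> 0"
  proof
    assume "v = 0"
    then have "u = 0"
      using * by (intro K_nondegenerate) (simp add: SK)
    then show False
      using assms[of 0] by simp
  qed
  then obtain t where t: "K v t \<noteq> 0"
    using K_nondegenerate by blast
  have "u = (K u t / K v t) *s v"
  proof (rule K_eqI)
    fix y
    have "K v (y - (K v y / K v t) *s t) = 0"
      using t by (simp add: SK)
    then have "K u (y - (K v y / K v t) *s t) = 0"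
      by (rule *)
    then show "K u y = K ((K u t / K v t) *s v) y"
      by (simp add: SK)
  qed
  with assms show False
    by blast
qed

text \<open>By \<open>perp\<close>, the \<open>K\<close>-complement of the plane is also orthogonal
  to it for \<open>S\<close>, so \<open>B\<close> splits into two planes; \<open>K\<close> stays
  nondegenerate on the complement.\<close>

lemma realizable_hyperbolic_pair:
  assumes ef: "K e f = 1"
    and perp: "\<And>y. K e y = 0 \<Longrightarrow> K f y = 0 \<Longrightarrow> S e y = 0 \<and> S f y = 0"
    and S: "S e e \<noteq> 0 \<or> S e f \<noteq> 0"
  shows realizable
proof -
  obtain p q where pq: "K e p = 0" "K f p = 0" "K e q = 0" "K f q = 0"
    and spans: "\<And>y. \<exists>a b c d. y = a *s e + b *s f + c *s p + d *s q"
    and ind: "\<And>c d. c *s p + d *s q = 0 \<Longrightarrow> c = 0 \<and> d = 0"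
    using hyperbolic_pair_complement[OF ef] by metis
  have pq': "K p e = 0" "K p f = 0" "K q e = 0" "K q f = 0"
    using pq K_commute[of p e] K_commute[of p f] K_commute[of q e] K_commute[of q f] by simp_all
  have "K p q \<noteq> 0"
  proof
    assume "K p q = 0"
    then have "K p v = 0" for v
      using spans[of v] pq' by (auto simp: SK)
    then have "p = 0"
      by (rule K_nondegenerate)
    then show False
      using ind[of 1 0] by simp
  qed
  moreover have "S e p = 0" "S f p = 0" "S e q = 0" "S f q = 0"
    using perp pq by auto
  moreover have "S p e = 0" "S p f = 0" "S q e = 0" "S q f = 0"
    using calculation S_commute by metis+
  ultimately show ?thesis
    using pq pq' ef S
    by (intro realizable_two_planes[of e f p q]) (auto simp: B_eq)
qed

text \<open>The Lagrangian plane of \<open>u, v\<close> is completed by dual vectors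
  \<open>w, t\<close>. If \<open>S w t\<close> vanishes, \<open>B\<close> splits into the planes of
  \<open>u, w\<close> and \<open>v, t\<close>; otherwise table 1 arises.\<close>

lemma realizable_dual_eigenvectors:
  assumes uv: "X u = l *s u" "X v = (- l) *s v" "u \<noteq> 0" "v \<noteq> 0" "K u v = 0"
    and l: "l \<noteq> 0" "l \<noteq> - 1"
  shows realizable
proof -
  have S: "S u y = l * K u y" "S v y = - l * K v y" for y
    using K_X[of u y] K_X[of v y] uv by (simp_all add: SK)
  have "l \<noteq> - l"
  proof
    assume "l = - l"
    then have "2 * l = 0"
      by (simp add: eq_neg_iff_add_eq_0)
    then show False
      using l by simp
  qed
  then have nm: "u \<noteq> c *s v" "v \<noteq> c *s u" for c
    using uv X_scale[of c u] X_scale[of c v] vec.scale_cancel_right[of l u "- l"]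
      vec.scale_cancel_right[of l v "- l"]
    by (metis vec.scale_left_commute)+
  obtain w0 where w0: "K u w0 = 1" "K v w0 = 0"
    using dual_vector nm by blast
  obtain t0 where t0: "K v t0 = 1" "K u t0 = 0"
    using dual_vector nm by blast
  \<comment> \<open>The terms with denominator \<open>2 * l\<close> make \<open>w\<close> and
    \<open>t\<close> isotropic, as \<open>S u w0 = l\<close> and \<open>S v t0 = - l\<close>; the
    term \<open>K w0 t0 *s u\<close> achieves \<open>K w t = 0\<close>.\<close>
  define w where "w = w0 - (S w0 w0 / (2 * l)) *s u"
  define t where "t = t0 + K w0 t0 *s u + (S t0 t0 / (2 * l)) *s v"
  have vu: "K v u = 0" "K w0 u = - 1" "K w0 v = 0" "K t0 v = - 1" "K t0 u = 0"
      "S w0 u = l" "S w0 v = 0" "S t0 u = 0" "S t0 v = - l" "K u v = 0"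
    using w0 t0 S uv K_commute[of v u] K_commute[of w0 u] K_commute[of w0 v] K_commute[of t0 u]
      K_commute[of t0 v] S_commute[of w0 u] S_commute[of w0 v] S_commute[of t0 u] S_commute[of t0 v]
    by simp_all
  have K: "K u w = 1" "K v w = 0" "K u t = 0" "K v t = 1" "K w t = 0"
    using w0 t0 vu by (simp_all add: w_def t_def SK)
  have K': "K w u = - 1" "K w v = 0" "K t u = 0" "K t v = - 1" "K t w = 0"
    using K K_commute[of w u] K_commute[of w v] K_commute[of t u] K_commute[of t v] K_commute[of t w]
    by simp_all
  have Sww: "S w w = 0" and Stt: "S t t = 0"
    using w0 t0 vu l S by (simp_all add: w_def t_def SK)
  have S1: "S u u = 0" "S u v = 0" "S v u = 0" "S v v = 0"
      "S u w = l" "S u t = 0" "S v w = 0" "S v t = - l"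
    using S K vu by auto
  have S1': "S w u = l" "S t u = 0" "S w v = 0" "S t v = - l"
    using S1 S_commute[of w u] S_commute[of t u] S_commute[of w v] S_commute[of t v] by simp_all
  have Stw: "S t w = S w t"
    by (rule S_commute)
  note facts = K K' Sww Stt S1 S1' Stw vu(1,10)
  show ?thesis
  proof (cases "S w t = 0")
    case True
    have "S t w = 0"
      using Stw True by simp
    show ?thesis
      by (rule realizable_two_planes[of u w v t])
        (simp_all add: B_eq K K' S1 S1' vu True \<open>S t w = 0\<close> l)
  next
    case False
    define b where "b = S w t"
    \<comment> \<open>\<open>c\<close> is the ratio of \<open>B w u = l - 1\<close> to
      \<open>B u w = l + 1\<close>, and \<open>k\<close> is the value that \<open>B w t'\<close>
      takes after the shift below.\<close>
    define c where "c = (l - 1) / (l + 1)"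
    define k where "k = b * (l + 1) / (2 * l)"
    have l1: "l + 1 \<noteq> 0"
      using l by (simp add: add_eq_0_iff2)
    have b: "b \<noteq> 0" and k: "k \<noteq> 0"
      using False l l1 by (simp_all add: b_def k_def)
    have c: "c \<notin> {1, - 1}"
      using l l1 by (auto simp: c_def divide_eq_eq)
    have cl: "(l - 1) = c * (l + 1)"
      using l1 by (simp add: c_def)
    \<comment> \<open>the shift by \<open>u\<close> is the one for which \<open>B t' w\<close> and \<open>B w t'\<close> have ratio \<open>c\<close>\<close>
    define h where "h = b / (2 * l)"
    define t' where "t' = t - h *s u"
    have wt: "B w t' = k" "B t' w = c * k"
    proof -
      have "B w t' = b - h * (l - 1)"
        using facts by (simp add: t'_def B_eq SK b_def algebra_simps)
      also have "\<dots> = k"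
        using l by (simp add: k_def h_def field_simps)
      finally show "B w t' = k" .
      have "B t' w = b - h * (l + 1)"
        using facts by (simp add: t'_def B_eq SK b_def algebra_simps)
      also have "\<dots> = b * (l - 1) / (2 * l)"
        using l by (simp add: h_def field_simps)
      also have "\<dots> = c * k"
        using l1 by (simp add: k_def c_def)
      finally show "B t' w = c * k" .
    qed
    have Bt: "B u t' = 0" "B t' u = 0" "B v t' = - (l - 1)" "B t' v = - (l + 1)" "B t' t' = 0"
      using facts l by (simp_all add: t'_def B_eq SK algebra_simps)
    have Bo: "B u u = 0" "B u v = 0" "B v u = 0" "B v v = 0" "B w w = 0" "B v w = 0" "B w v = 0"
      "B u w = l + 1" "B w u = l - 1"
      using facts by (simp_all add: B_eq)
    have l2: "(- l - 1) / (l + 1) = - 1"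
      using l1 by (simp add: divide_eq_eq)
    \<comment> \<open>The factors make \<open>B ?x1 w\<close>, \<open>B w ?x2\<close> and
      \<open>B ?x2 ?x3\<close> equal to 1; the opposite products are then \<open>c\<close>.\<close>
    let ?x1 = "(1 / (l + 1)) *s u" and ?x2 = "(1 / k) *s t'" and ?x3 = "(- k / (l + 1)) *s v"
    have "gram [?x1, ?x2, ?x3, w]
      [((1,4), 1), ((2,3), 1), ((2,4), c), ((3,2), c), ((4,1), c), ((4,2), 1)]"
      using wt Bt Bo k l1 by (simp add: gram_Cons entry_def bilinear cl l2)
    with c show ?thesis
      by (intro realizableI[OF t1])
  qed
qed

text \<open>Eigenvectors for \<open>l\<close> and \<open>- l\<close> either span a Lagrangian plane
  or scale to a hyperbolic pair. In the second case \<open>S\<close> is proportional to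
  \<open>K\<close> on each of them, so their plane splits off.\<close>

lemma realizable_nonzero_eigenvalue:
  assumes u: "X u = l *s u" "u \<noteq> 0" "l \<noteq> 0"
  shows realizable
proof -
  obtain v where v: "X v = (- l) *s v" "v \<noteq> 0"
    using negative_eigenvector u by blast
  have S: "S u y = l * K u y" "S v y = - l * K v y" for y
    using K_X[of u y] K_X[of v y] u v by (simp_all add: SK)
  show ?thesis
  proof (cases "K u v = 0")
    case True
    show ?thesis
    proof (cases "l = - 1")
      case False
      then show ?thesis
        using realizable_dual_eigenvectors u v True by blast
    next
      \<comment> \<open>Exchanging \<open>u\<close> and \<open>v\<close> replaces the eigenvalue -1
        by 1.\<close>
      case l: True
      show ?thesis
        using realizable_dual_eigenvectors[of v "- l" u] u v True l K_commute[of v u] by simp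
    qed
  next
    case False
    define w where "w = (1 / K u v) *s v"
    have "K u w = 1"
      using False by (simp add: w_def SK)
    moreover have "S w y = - l * K w y" for y
      by (simp add: w_def SK S)
    ultimately show ?thesis
      using S u by (intro realizable_hyperbolic_pair[of u w]) auto
  qed
qed

subsection \<open>Nilpotent operators\<close>

text \<open>The form \<open>K (X (X (X u))) v\<close> is symmetric and nonzero, so some
  \<open>g0\<close> is not isotropic for it. After one correction its Jordan chain has
  \<open>K\<close>-pairings only between opposite members, which is table 3 up to scale.\<close>

lemma realizable_regular_nilpotent:
  assumes X4: "\<And>v. X (X (X (X v))) = 0" and X3: "X (X (X v)) \<noteq> 0"
  shows realizable
proof -
  have sym: "K (X (X (X u))) v = K (X (X (X v))) u" for u v
  proof -
    have "K (X (X (X u))) v = - K u (X (X (X v)))"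
      by (simp add: K_X_shift)
    then show ?thesis
      using K_commute[of u "X (X (X v))"] by simp
  qed
  have "\<exists>g. K (X (X (X g))) g \<noteq> 0"
  proof (rule ccontr)
    assume no: "\<not> ?thesis"
    have "K (X (X (X u))) y = 0" for u y
    proof -
      have "K (X (X (X (u + y)))) (u + y) = 0"
        using no by blast
      then show ?thesis
        using no sym[of y u] by (simp add: X_add SK)
    qed
    with X3 show False
      using K_nondegenerate by blast
  qed
  then obtain g0 where k: "K (X (X (X g0))) g0 \<noteq> 0"
    by blast
  define k where "k = K (X (X (X g0))) g0"
  \<comment> \<open>The multiple of \<open>X (X g0)\<close> is chosen to make
    \<open>K (X g) g = 0\<close>; the value \<open>k\<close> survives because the fourth power of
    \<open>X\<close> vanishes.\<close>
  define g where "g = g0 - (K (X g0) g0 / (2 * k)) *s X (X g0)"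
  define d where "d = X g"
  define e where "e = X d"
  define f where "f = X e"
  have shift: "K (X (X a)) b = K a (X (X b))" for a b
    by (simp add: K_X_shift)
  have Xf: "X f = 0" "f = X (X (X g0))" "e = X (X g0)"
    using X4 by (simp_all add: f_def e_def d_def g_def X_diff X_scale X_zero)
  have fg: "K f g = k"
    using shift[of "X g0" "X (X g0)"] X4 by (simp add: Xf(2) g_def SK k_def)
  have fe: "K f e = 0" "K f d = 0"
    using K_X_right[of f d] K_X_right[of f g] K_X[of f d] K_X[of f g] Xf
    by (simp_all add: e_def d_def SK)
  have eg: "K e g = 0"
    using shift[of g g] K_commute[of "X (X g)" g] by (simp add: e_def d_def)
  have ed: "K e d = - k"
    using K_X_shift[of e g] fg by (simp add: f_def d_def eq_neg_iff_add_eq_0 add.commute)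
  have dg: "K d g = 0"
  proof -
    have "K (X (X (X g0))) (X (X g0)) = 0"
      using fe Xf by simp
    moreover have "K (X g0) (X (X g0)) = k"
      using K_X_shift[of "X (X g0)" g0] K_commute[of "X g0" "X (X g0)"] by (simp add: k_def)
    moreover have "d = X g0 - (K (X g0) g0 / (2 * k)) *s X (X (X g0))"
      by (simp add: d_def g_def X_diff X_scale)
    ultimately show ?thesis
      using k by (simp add: g_def SK k_def[symmetric])
  qed
  have K': "K e f = 0" "K d f = 0" "K g f = - k" "K g e = 0" "K d e = k" "K g d = 0"
    using fg fe eg ed dg K_commute[of e f] K_commute[of d f] K_commute[of g f] K_commute[of g e]
      K_commute[of d e] K_commute[of g d] by auto
  have S: "S f y = 0" "S e y = K f y" "S d y = K e y" "S g y = K d y" for y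
    using K_X[of f y] K_X[of e y] K_X[of d y] K_X[of g y] Xf by (simp_all add: SK f_def e_def d_def)
  \<comment> \<open>All nonzero pairings in the chain are \<open>k\<close> up to sign, so a scalar
    with \<open>r * r * k = - 1\<close> normalizes them at once.\<close>
  define r where "r = csqrt (- (1 / k))"
  have r: "r * r = - (1 / k)"
    by (simp add: r_def csqrt_squared)
  have kn: "k \<noteq> 0"
    using k by (simp add: k_def)
  have r2: "r * (r * k) = - 1" "k * (r * r) = - 1" "r * (k * r) = - 1"
    using r kn by (simp_all add: field_simps)
  show ?thesis
    by (intro realizableI[OF t3, of "[r *s f, r *s e, r *s d, (- r) *s g]"])
      (use fg fe eg ed dg K' S r2 in \<open>simp add: gram_Cons entry_def B_eq SK mult.assoc\<close>)
qed

text \<open>The form \<open>K (X (X u)) v\<close> is alternating, so \<open>X\<^sup>2\<close> has even rank; if \<open>X\<^sup>2 \<noteq> 0 = X\<^sup>3\<close>, there would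
  be two Jordan chains of length three.\<close>

lemma square_zero:
  assumes X3: "\<And>v. X (X (X v)) = 0"
  shows "X (X v) = 0"
proof (rule ccontr)
  assume "X (X v) \<noteq> 0"
  then obtain w where w: "K (X (X v)) w \<noteq> 0"
    using K_nondegenerate by blast
  have alt: "K (X (X u)) u = 0" for u
    by (simp add: K_X_shift[of "X u" u])
  have skew: "K (X (X w)) v \<noteq> 0"
  proof -
    have "K (X (X w)) v = K w (X (X v))"
      by (simp add: K_X_shift)
    then show ?thesis
      using w K_commute[of w "X (X v)"] by simp
  qed
  \<comment> \<open>Five vectors in dimension four are dependent; applying \<open>X\<close> twice
    isolates the coefficients of \<open>v, w\<close>, and then once those of
    \<open>X v, X w\<close>.\<close>
  obtain a where a: "\<exists>i\<le>4. a i \<noteq> 0"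
    "(\<Sum>i\<le>4. a i *s [v, w, X v, X w, X (X v)] ! i) = 0"
    using five_vectors_dependent[of "\<lambda>i. [v, w, X v, X w, X (X v)] ! i"] by blast
  then have sum: "a 0 *s v + a 1 *s w + a 2 *s X v + a 3 *s X w + a 4 *s X (X v) = 0"
    by (simp add: eval_nat_numeral)
  have "X (X (a 0 *s v + a 1 *s w + a 2 *s X v + a 3 *s X w + a 4 *s X (X v))) = 0"
    unfolding sum by (simp add: X_zero)
  then have "a 0 *s X (X v) + a 1 *s X (X w) = 0"
    by (simp add: X_add X_scale X_zero X3)
  then have "K (a 0 *s X (X v) + a 1 *s X (X w)) y = 0" for y
    by (simp add: SK)
  from this[of v] this[of w] have a01: "a 0 = 0" "a 1 = 0"
    using alt skew w by (auto simp: SK)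
  have "X (a 2 *s X v + a 3 *s X w + a 4 *s X (X v)) = 0"
    using sum a01 by (simp add: X_zero)
  then have "a 2 *s X (X v) + a 3 *s X (X w) = 0"
    by (simp add: X_add X_scale X_zero X3)
  then have "K (a 2 *s X (X v) + a 3 *s X (X w)) y = 0" for y
    by (simp add: SK)
  from this[of v] this[of w] have a23: "a 2 = 0" "a 3 = 0"
    using alt skew w by (auto simp: SK)
  have "a 4 = 0"
    using sum a01 a23 \<open>X (X v) \<noteq> 0\<close> by simp
  have "a i = 0" if "i \<le> 4" for i
  proof -
    have "i = 0 \<or> i = 1 \<or> i = 2 \<or> i = 3 \<or> i = 4"
      using that by auto
    then show ?thesis
      using a01 a23 \<open>a 4 = 0\<close> by auto
  qed
  with a(1) show False
    by blast
qed

text \<open>What remains besides the two preceding cases is \<open>X\<close> of square zero. There a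
  nonisotropic \<open>u\<close> and a multiple \<open>f\<close> of \<open>X u\<close> form a
  hyperbolic pair; since \<open>S f\<close> vanishes and \<open>S u\<close> is a multiple of
  \<open>K f\<close>, their plane splits off.\<close>

lemma realizable_nondegenerate:
  assumes "B u u \<noteq> 0"
  shows realizable
proof (cases "\<exists>l u. l \<noteq> 0 \<and> u \<noteq> 0 \<and> X u = l *s u")
  case True
  then show ?thesis
    using realizable_nonzero_eigenvalue by blast
next
  case False
  then have X4: "X (X (X (X v))) = 0" for v
    using nonzero_eigenvalue_or_nilpotent by blast
  show ?thesis
  proof (cases "\<exists>v. X (X (X v)) \<noteq> 0")
    case True
    then show ?thesis
      using realizable_regular_nilpotent X4 by blast
  next
    case False
    then have X2: "X (X v) = 0" for v
      using square_zero by blast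
    have s: "S u u \<noteq> 0"
      using assms by (simp add: S_def)
    define f where "f = (- 1 / S u u) *s X u"
    have "K u f = 1"
      using s by (simp add: f_def SK K_X_right)
    moreover have "S f y = 0" for y
      using K_X[of "X u" y] by (simp add: f_def SK X2)
    moreover have "K f y = (- 1 / S u u) * S u y" for y
      by (simp add: f_def SK K_X)
    ultimately show ?thesis
      using s by (intro realizable_hyperbolic_pair[of u f]) auto
  qed
qed

end

section \<open>Classification of bilinear forms on four-space\<close>

context bilinear_form
begin

theorem realizable_if_radical_trivial:
  assumes nondeg: "\<And>u. (\<And>v. B u v = 0 \<and> B v u = 0) \<Longrightarrow> u = 0"
    and nonalt: "B u u \<noteq> 0"
  shows realizable
proof (cases "\<forall>u v. K u v = 0")
  case True
  show ?thesis
  proof (rule realizable_symmetric)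
    show "K u v = 0" for u v
      using True by blast
    show "u = 0" if "\<And>v. S u v = 0" for u
      by (rule nondeg) (use that True S_commute[of _ u] in \<open>simp add: B_eq\<close>)
  qed
next
  case False
  then obtain e0 f where "K e0 f \<noteq> 0"
    by blast
  define e where "e = (1 / K e0 f) *s e0"
  have ef: "K e f = 1"
    using \<open>K e0 f \<noteq> 0\<close> by (simp add: e_def SK)
  obtain p q where pq: "K e p = 0" "K f p = 0" "K e q = 0" "K f q = 0"
    and spans: "\<And>y. \<exists>a b c d. y = a *s e + b *s f + c *s p + d *s q"
    and ind: "\<And>c d. c *s p + d *s q = 0 \<Longrightarrow> c = 0 \<and> d = 0"
    using hyperbolic_pair_complement[OF ef] by metis
  have pq': "K p e = 0" "K p f = 0" "K q e = 0" "K q f = 0" "K f e = - 1"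
    using pq ef K_commute[of p e] K_commute[of p f] K_commute[of q e] K_commute[of q f]
      K_commute[of f e] by simp_all
  \<comment> \<open>The value \<open>K p q\<close> decides whether \<open>K\<close> has rank two or
    four.\<close>
  show ?thesis
  proof (cases "K p q = 0")
    case True
    then have "K q p = 0"
      using K_commute[of q p] by simp
    have "K p v = 0" "K q v = 0" for v
      using spans[of v] pq' True \<open>K q p = 0\<close> by (auto simp: SK)
    then show ?thesis
      using realizable_skew_rank_two[OF nondeg ef _ _ spans] ind unfolding indep_def by blast
  next
    case False
    define k where "k = K p q"
    have k: "k \<noteq> 0" "K p q = k" "K q p = - k"
      using False K_commute[of q p] by (simp_all add: k_def)
    \<comment> \<open>The coefficients are forced by \<open>K (X u) v = S u v\<close> on the basis
      \<open>e, f, p, q\<close>, where only \<open>e, f\<close> and \<open>p, q\<close> pair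
      nontrivially under \<open>K\<close>.\<close>
    define X where "X u = S u f *s e - S u e *s f + (S u q / k) *s p - (S u p / k) *s q" for u
    interpret skew_nondegenerate B X
    proof
      fix u v
      obtain a b c d where v: "v = a *s e + b *s f + c *s p + d *s q"
        using spans by blast
      show "K (X u) v = S u v"
        using pq pq' k ef by (simp add: X_def v SK algebra_simps)
    next
      fix u
      assume 0: "\<And>v. K u v = 0"
      obtain a b c d where u: "u = a *s e + b *s f + c *s p + d *s q"
        using spans by blast
      have "a = 0" "b = 0" "c = 0" "d = 0"
        using 0[of f] 0[of e] 0[of q] 0[of p] pq pq' k ef by (simp_all add: u SK)
      then show "u = 0"
        by (simp add: u)
    qed
    show ?thesis
      using realizable_nondegenerate nonalt by blast
  qed
qed

end

subsection \<open>Leibniz algebras with one-dimensional derived algebra\<close>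

context leibniz_algebra
begin

lemma bracket_simps:
  "bracket (a + b) c = bracket a c + bracket b c" "bracket a (b + c) = bracket a b + bracket a c"
  "bracket (scale r a) b = scale r (bracket a b)" "bracket a (scale r b) = scale r (bracket a b)"
  "bracket 0 b = 0" "bracket a 0 = 0"
  using linear_left[of c] linear_left[of b] linear_right[of a]
  by (auto simp: Vector_Spaces.linear_iff) (metis add_cancel_right_left)+

text \<open>If \<open>B a z\<close> were nonzero, bracketing with \<open>a\<close> would keep
  \<open>z\<close> in every term of the lower series. So \<open>[a, [b, c]]\<close> vanishes, and
  the Leibniz identity then kills \<open>[[p, q], b]\<close> as well, where \<open>z\<close> is a
  multiple of \<open>[p, q]\<close>.\<close>

lemma central_line:
  assumes nilp: nilpotent_algebra and dim: "dim (lower_series 2) = 1"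
  obtains z B where "z \<noteq> 0" "\<And>a b. bracket a b = scale (B a b) z"
    "\<And>a. B a z = 0" "\<And>a. B z a = 0"
proof -
  have L2: "lower_series 2 = span {bracket a b | a b. True}"
    by (simp add: numeral_2_eq_2)
  obtain C where C: "C \<subseteq> lower_series 2" "independent C" "lower_series 2 \<subseteq> span C" "card C = 1"
    using basis_exists[of "lower_series 2"] dim by metis
  then obtain z where z: "C = {z}"
    by (auto simp: card_1_singleton_iff)
  have "z \<noteq> 0"
    using C z by simp
  have "bracket a b \<in> span {z}" for a b
  proof -
    have "bracket a b \<in> lower_series 2"
      unfolding L2 by (rule span_base) blast
    then show ?thesis
      using C z by auto
  qed
  then have "\<exists>c. bracket a b = scale c z" for a b
    by (auto simp: span_singleton)
  then obtain B where B: "\<And>a b. bracket a b = scale (B a b) z"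
    by metis
  have az: "B a z = 0" for a
  proof (rule ccontr)
    assume c: "B a z \<noteq> 0"
    have "z \<in> lower_series (Suc n)" for n
    proof (induction n)
      case (Suc n)
      have "scale (1 / B a z) (bracket a z) \<in> lower_series (Suc (Suc n))"
        unfolding lower_series.simps by (intro span_scale span_base) (use Suc in blast)
      then show ?case
        using c B[of a z] by simp
    qed simp
    then have "lower_series m \<noteq> {0}" if "m > 0" for m
      using that \<open>z \<noteq> 0\<close> by (cases m) auto
    then show False
      using nilp unfolding nilpotent_algebra_def by blast
  qed
  then have az': "bracket a (bracket b c) = 0" for a b c
    using B[of b c] B[of a z] by (simp add: bracket_simps)
  have zb: "B z b = 0" for b
  proof -
    obtain p q where pq: "bracket p q \<noteq> 0"
    proof (rule ccontr)
      assume "\<not> thesis"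
      then have "{bracket a b | a b. True} \<subseteq> {0}"
        using that by blast
      then have "lower_series 2 \<subseteq> span {0}"
        unfolding L2 by (rule span_mono)
      then show False
        using C(1) z \<open>z \<noteq> 0\<close> by auto
    qed
    then have "z = scale (1 / B p q) (bracket p q)"
      using B[of p q] by auto
    moreover have "bracket (bracket p q) b = 0"
      using leibniz[of p q b] by (simp add: az')
    ultimately have "bracket z b = 0"
      by (metis bracket_simps(3) scale_zero_right)
    then show ?thesis
      using B[of z b] \<open>z \<noteq> 0\<close> by simp
  qed
  show thesis
    using that \<open>z \<noteq> 0\<close> B az zb by blast
qed

text \<open>A vector \<open>u\<close> of the radical spans an ideal, and a subspace containing
  \<open>z\<close> is an ideal because it contains all products. If \<open>u\<close> is outside
  \<open>span {z}\<close>, it has a complement containing \<open>z\<close>, which splits the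
  algebra.\<close>

lemma radical_if_not_split:
  assumes split: "\<not> split_algebra"
    and z: "z \<noteq> 0" "\<And>a b. bracket a b = scale (B a b) z"
    and u: "\<And>v. B u v = 0" "\<And>v. B v u = 0"
  shows "u \<in> span {z}"
proof (rule ccontr)
  assume u_z: "u \<notin> span {z}"
  then have "u \<noteq> 0" "u \<noteq> z"
    using span_zero span_base[of z "{z}"] by auto
  have ind: "independent {u, z}"
    using u_z z by (simp add: independent_insert)
  obtain C where C: "{u, z} \<subseteq> C" "independent C" "UNIV \<subseteq> span C"
    using maximal_independent_subset_extend[OF subset_UNIV ind] by metis
  define J where "J = span (C - {u})"
  have "z \<in> J"
    unfolding J_def using C(1) \<open>u \<noteq> z\<close> by (intro span_base) auto
  have "u \<notin> J"
    using C(1,2) unfolding J_def dependent_def by blast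
  have "bracket a w = 0 \<and> bracket w a = 0" if w: "w \<in> span {u}" for a w
  proof -
    obtain c where "w = scale c u"
      using w by (auto simp: span_singleton)
    then show ?thesis
      using bracket_simps(3)[of c u a] bracket_simps(4)[of a c u] z(2)[of u a] z(2)[of a u] u by simp
  qed
  then have "two_sided_ideal (span {u})"
    unfolding two_sided_ideal_def using span_zero by auto
  moreover have "two_sided_ideal J"
    unfolding two_sided_ideal_def using z(2) \<open>z \<in> J\<close> by (auto simp: J_def intro: span_scale)
  moreover have "span {u} \<inter> J = {0}"
  proof -
    have "scale c u = 0" if "scale c u \<in> J" for c
    proof (rule ccontr)
      assume "scale c u \<noteq> 0"
      then have "u = scale (1 / c) (scale c u)"
        by auto
      then have "u \<in> J"
        using that unfolding J_def by (metis span_scale)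
      then show False
        using \<open>u \<notin> J\<close> by blast
    qed
    then show ?thesis
      using span_zero by (auto simp: span_singleton J_def intro: exI[of _ 0])
  qed
  moreover have "{a + b | a b. a \<in> span {u} \<and> b \<in> J} = UNIV"
  proof -
    have "\<exists>a b. v = a + b \<and> a \<in> span {u} \<and> b \<in> J" for v
    proof -
      have "v \<in> span (insert u (C - {u}))"
        using C by (metis UNIV_I insert_Diff insert_subset subsetD)
      then obtain c where "v - scale c u \<in> J"
        unfolding J_def span_breakdown_eq by blast
      then show ?thesis
        by (intro exI[of _ "scale c u"] exI[of _ "v - scale c u"]) (auto simp: span_singleton)
    qed
    then show ?thesis
      by blast
  qed
  moreover have "span {u} \<noteq> {0}" "J \<noteq> {0}"
    using span_base[of u "{u}"] \<open>u \<noteq> 0\<close> \<open>z \<in> J\<close> z(1) by auto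
  ultimately show False
    using split unfolding split_algebra_def by blast
qed

lemma nonalternating_if_non_Lie:
  assumes non_Lie and z: "\<And>a b. bracket a b = scale (B a b) z"
  shows "\<exists>u. B u u \<noteq> 0"
proof (rule ccontr)
  assume no: "\<not> ?thesis"
  then have "{bracket a a | a. True} = {0}"
    using z by auto
  then show False
    using assms(1) unfolding non_Lie_def Leib_def by simp
qed

text \<open>\<open>f\<close> parametrizes a complement of the line, so that the bracket can be
  pulled back to a form on \<open>complex^4\<close>.\<close>

lemma complement_of_line:
  assumes dim: "dim UNIV = 5" and z: "z \<noteq> 0"
  obtains f :: "complex^4 \<Rightarrow> 'a" where "Vector_Spaces.linear (*s) scale f"
    "\<And>v. f v \<in> span {z} \<Longrightarrow> v = 0" "\<And>a. \<exists>v c. a = f v + scale c z"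
proof -
  have "independent {z}"
    using z by simp
  then obtain C where C: "{z} \<subseteq> C" "independent C" "UNIV \<subseteq> span C"
    using maximal_independent_subset_extend[OF subset_UNIV] by metis
  have "card C = 5"
    using basis_card_eq_dim[of C UNIV] C dim by simp
  then have "finite C"
    using card.infinite by fastforce
  define D where "D = C - {z}"
  have D: "finite D" "card D = 4" "C = insert z D" "D \<subseteq> C"
    using C(1) \<open>card C = 5\<close> \<open>finite C\<close> by (auto simp: D_def)
  obtain b :: "4 \<Rightarrow> 'a" where b: "bij_betw b UNIV D"
    using finite_same_card_bij[of "UNIV :: 4 set" D] D by auto
  define f where "f v = (\<Sum>i\<in>UNIV. scale (v $ i) (b i))" for v :: "complex^4"
  show thesis
  proof
    show "Vector_Spaces.linear (*s) scale f"
      unfolding Vector_Spaces.linear_iff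
      by (auto simp: f_def vec.vector_space_axioms vector_space_axioms scale_left_distrib
        sum.distrib scale_sum_right)
    show "\<exists>v c. a = f v + scale c z" for a
    proof -
      have "a \<in> span (insert z D)"
        using C(3) D(3) by auto
      then obtain c where "a - scale c z \<in> span D"
        by (auto simp: span_breakdown_eq)
      then obtain u where u: "a - scale c z = (\<Sum>w\<in>D. scale (u w) w)"
        using span_finite[OF D(1)] by auto
      also have "\<dots> = f (\<chi> i. u (b i))"
        unfolding f_def using sum.reindex_bij_betw[OF b, of "\<lambda>w. scale (u w) w"] by simp
      finally have "a = f (\<chi> i. u (b i)) + scale c z"
        by (simp add: algebra_simps)
      then show ?thesis
        by blast
    qed
    fix v
    assume "f v \<in> span {z}"
    then obtain c where c: "f v = scale c z"
      by (auto simp: span_singleton)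
    have "f v \<in> span D"
      unfolding f_def using b by (intro span_sum span_scale span_base) (auto simp: bij_betw_def)
    moreover have "z \<notin> span D"
      using C(1,2) unfolding D_def dependent_def by blast
    ultimately have "c = 0"
    proof -
      have "z = scale (1 / c) (f v)" if "c \<noteq> 0"
        using that c by simp
      then show ?thesis
        using \<open>f v \<in> span D\<close> \<open>z \<notin> span D\<close> by (metis span_scale)
    qed
    define u where "u w = v $ inv_into UNIV b w" for w
    have ub: "u (b i) = v $ i" for i
      using b by (simp add: u_def bij_betw_def)
    have "(\<Sum>w\<in>D. scale (u w) w) = 0"
      using sum.reindex_bij_betw[OF b, of "\<lambda>w. scale (u w) w"] c \<open>c = 0\<close> by (simp add: ub f_def)
    then have "u w = 0" if "w \<in> D" for w
      using independentD[OF C(2) D(1,4)] that by blast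
    then have "v $ i = 0" for i
      using ub[of i] b by (metis UNIV_I bij_betwE)
    then show "v = 0"
      by (simp add: vec_eq_iff)
  qed
qed

theorem exists_listed_basis:
  assumes "\<not> split_algebra" non_Lie nilpotent_algebra "dim UNIV = 5" "dim (lower_series 2) = 1"
  obtains x T where "listed T" "basis5 x" "products_given_by x T"
proof -
  obtain z B where z: "z \<noteq> 0" "\<And>a b. bracket a b = scale (B a b) z"
    and Bz: "\<And>a. B a z = 0" "\<And>a. B z a = 0"
    using central_line[OF assms(3,5)] by blast
  have B: "B (a + b) c = B a c + B b c" "B a (b + c) = B a b + B a c"
      "B (scale r a) b = r * B a b" "B a (scale r b) = r * B a b" for a b c r
    using bracket_simps(1)[of a b c] bracket_simps(2)[of a b c] bracket_simps(3)[of r a b]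
      bracket_simps(4)[of a r b] z(1)
    by (simp_all add: z(2) scale_left_distrib[symmetric])
  have B0: "B 0 b = 0" for b
    using B(3)[of 0 0 b] by simp
  have B_sum: "B (\<Sum>i\<in>I. g i) b = (\<Sum>i\<in>I. B (g i) b)" "B b (\<Sum>i\<in>I. g i) = (\<Sum>i\<in>I. B b (g i))"
    if "finite I" for g b and I :: "nat set"
    using that B(3,4)[of 0 0 b] B(4)[of b 0 0] by (induction I rule: finite_induct) (simp_all add: B)
  obtain f :: "complex^4 \<Rightarrow> 'a" where f: "Vector_Spaces.linear (*s) scale f"
    and f_z: "\<And>v. f v \<in> span {z} \<Longrightarrow> v = 0" and f_onto: "\<And>a. \<exists>v c. a = f v + scale c z"
    using complement_of_line[OF assms(4) z(1)] by metis
  have f_simps: "f (u + v) = f u + f v" "f (c *s u) = scale c (f u)" for u v c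
    using f by (auto simp: Vector_Spaces.linear_iff)
  \<comment> \<open>Since \<open>z\<close> pairs to zero with everything, \<open>B\<close> is
    determined by its values on the complement.\<close>
  interpret F: bilinear_form "\<lambda>u v. B (f u) (f v)"
    by unfold_locales (simp_all add: f_simps B)
  have "F.realizable"
  proof -
    obtain a where "B a a \<noteq> 0"
      using nonalternating_if_non_Lie[OF assms(2) z(2)] by blast
    moreover obtain v c where "a = f v + scale c z"
      using f_onto by blast
    ultimately have v: "B (f v) (f v) \<noteq> 0"
      by (simp add: B Bz)
    show ?thesis
    proof (rule F.realizable_if_radical_trivial[OF _ v])
      fix u
      assume 0: "\<And>v. B (f u) (f v) = 0 \<and> B (f v) (f u) = 0"
      have "B (f u) a = 0" "B a (f u) = 0" for a
        using f_onto[of a] 0 by (auto simp: B Bz)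
      then show "u = 0"
        using radical_if_not_split[OF assms(1) z] f_z by blast
    qed
  qed
  then obtain xs T where T: "listed T" and gram: "F.gram xs T"
    unfolding F.realizable_def by blast
  \<comment> \<open>List positions start at 0 and table indices at 1; index 5 is reserved for
    \<open>z\<close>.\<close>
  define x where "x i = (if i = 5 then z else f (xs ! (i - 1)))" for i
  have x5: "x 5 = z"
    by (simp add: x_def)
  have Bx: "B (x i) (x j) = entry T i j" if "i \<in> {1..4}" "j \<in> {1..4}" for i j
    using gram that by (simp add: F.gram_def x_def)
  have entry_5: "entry T i 5 = 0" "entry T 5 i = 0" for i
    using listed_entry_5[OF T] by (simp_all add: entry_def)
  have range5: "i = 5 \<or> i \<in> {1..4}" if "i \<in> {1..5}" for i :: nat
    using that by auto
  have "B (x i) (x j) = entry T i j" if "i \<in> {1..5}" "j \<in> {1..5}" for i j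
    using range5[OF that(1)] range5[OF that(2)] Bx by (auto simp: x5 Bz entry_5)
  then have "products_given_by x T"
    unfolding products_given_by_def by (auto simp: z(2) x5 entry_def split: option.splits)
  have "inj_on x {1..5} \<and> independent (x ` {1..5})"
  proof (rule independent_familyI)
    fix a i
    assume 0: "(\<Sum>i\<in>{1..5}. scale (a i) (x i)) = 0" and i: "i \<in> {1..5::nat}"
    have "a i = 0" if "i \<in> {1..4}" for i
    proof (rule listed_nondegenerate[OF T _ _ that])
      fix j :: nat
      assume j: "j \<in> {1..4}"
      \<comment> \<open>Pairing the relation with \<open>x j\<close> removes its last term and
        leaves the equations of \<open>listed_nondegenerate\<close>.\<close>
      have "B (\<Sum>i\<in>{1..5}. scale (a i) (x i)) (x j) = 0" "B (x j) (\<Sum>i\<in>{1..5}. scale (a i) (x i)) = 0"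
        unfolding 0 using B(3)[of 0 0 "x j"] B(4)[of "x j" 0 0] by simp_all
      then have "(\<Sum>i\<in>{1..5}. a i * B (x i) (x j)) = 0" "(\<Sum>i\<in>{1..5}. a i * B (x j) (x i)) = 0"
        by (simp_all add: B_sum B)
      then have "(\<Sum>i\<in>{1..4}. a i * B (x i) (x j)) = 0" "(\<Sum>i\<in>{1..4}. a i * B (x j) (x i)) = 0"
        unfolding sum_1_5 x5 Bz by simp_all
      then show "(\<Sum>i\<in>{1..4}. a i * entry T i j) = 0" "(\<Sum>i\<in>{1..4}. a i * entry T j i) = 0"
        using Bx j by simp_all
    qed
    moreover from this have "a 5 = 0"
      using 0 z(1) unfolding sum_1_5 x5 by simp
    ultimately show "a i = 0"
      using range5[OF i] by blast
  qed simp
  moreover obtain C where C: "independent C" "UNIV \<subseteq> span C" "card C = dim UNIV"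
    using basis_exists[of UNIV] by metis
  \<comment> \<open>Finite dimension turns five independent vectors into a spanning set.\<close>
  interpret finite_dimensional_vector_space scale C
    by unfold_locales (use C assms(4) card.infinite in fastforce)+
  have "UNIV \<subseteq> span (x ` {1..5})"
    using calculation assms(4) by (intro card_ge_dim_independent) (auto simp: card_image)
  ultimately have "basis5 x"
    unfolding basis5_def by blast
  then show thesis
    using that T \<open>products_given_by x T\<close> by blast
qed

end

section \<open>Transport to \<open>complex^5\<close>\<close>

theorem theorem2p4:
  fixes scale :: "complex \<Rightarrow> 'a::ab_group_add \<Rightarrow> 'a"
    and bracket :: "'a \<Rightarrow> 'a \<Rightarrow> 'a"
  assumes "leibniz_algebra scale bracket"
    and "\<not> leibniz_algebra.split_algebra scale bracket"
    and "leibniz_algebra.non_Lie scale bracket"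
    and "leibniz_algebra.nilpotent_algebra scale bracket"
    and "vector_space.dim scale (UNIV :: 'a set) = 5"
    and "vector_space.dim scale (leibniz_algebra.lower_series scale bracket 2) = 1"
  shows "\<exists>(br :: complex^5 \<Rightarrow> complex^5 \<Rightarrow> complex^5) (x :: nat \<Rightarrow> complex^5).
      leibniz_algebra (*s) br \<and>
      leibniz_isomorphic scale bracket (*s) br \<and>
      leibniz_algebra.basis5 (*s) x \<and>
      (
        (\<exists>c. c \<notin> {1, - 1} \<and> leibniz_algebra.products_given_by (*s) br x
           [((1,4), 1), ((2,3), 1), ((2,4), c), ((3,2), c), ((4,1), c), ((4,2), 1)]) \<or>
        leibniz_algebra.products_given_by (*s) br x
           [((1,4), 1), ((2,3), 1), ((2,4), 1), ((3,2), 1), ((4,1), 1), ((4,2), - 1)] \<or>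
        leibniz_algebra.products_given_by (*s) br x
           [((1,4), 1), ((2,3), 1), ((2,4), 1), ((3,2), - 1), ((3,3), 1), ((4,1), - 1), ((4,2), 1)] \<or>
        leibniz_algebra.products_given_by (*s) br x
           [((1,3), 1), ((3,2), 1), ((4,4), 1)] \<or>
        leibniz_algebra.products_given_by (*s) br x
           [((1,3), 1), ((2,2), 1), ((2,3), 1), ((3,1), 1), ((3,2), - 1), ((4,4), 1)] \<or>
        leibniz_algebra.products_given_by (*s) br x
           [((1,2), 1), ((2,1), - 1), ((3,4), 1), ((4,3), - 1), ((4,4), 1)] \<or>
        (\<exists>c. c \<notin> {1, - 1} \<and> leibniz_algebra.products_given_by (*s) br x
           [((1,2), 1), ((2,1), - 1), ((3,4), 1), ((4,3), c)]) \<or>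
        leibniz_algebra.products_given_by (*s) br x
           [((1,2), 1), ((2,1), - 1), ((2,2), 1), ((3,4), 1), ((4,3), - 1), ((4,4), 1)] \<or>
        (\<exists>c. c \<notin> {1, - 1} \<and> leibniz_algebra.products_given_by (*s) br x
           [((1,2), 1), ((2,1), - 1), ((2,2), 1), ((3,4), 1), ((4,3), c)]) \<or>
        (\<exists>c1 c2. c1 \<notin> {1, - 1} \<and> c2 \<notin> {1, - 1} \<and> leibniz_algebra.products_given_by (*s) br x
           [((1,2), 1), ((2,1), c1), ((3,4), 1), ((4,3), c2)]) \<or>
        leibniz_algebra.products_given_by (*s) br x
           [((1,2), 1), ((2,1), - 1), ((3,3), 1), ((4,4), 1)] \<or>
        leibniz_algebra.products_given_by (*s) br x
           [((1,2), 1), ((2,1), - 1), ((2,2), 1), ((3,3), 1), ((4,4), 1)] \<or>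
        (\<exists>c. c \<notin> {1, - 1} \<and> leibniz_algebra.products_given_by (*s) br x
           [((1,2), 1), ((2,1), c), ((3,3), 1), ((4,4), 1)]) \<or>
        leibniz_algebra.products_given_by (*s) br x
           [((1,1), 1), ((2,2), 1), ((3,3), 1), ((4,4), 1)]
      )"
proof -
  interpret leibniz_algebra scale bracket
    by fact
  obtain x T where T: "listed T" and x: "basis5 x" "products_given_by x T"
    using exists_listed_basis assms by blast
  have ind: "independent (x ` {1..5})" and span: "span (x ` {1..5}) = UNIV" and inj: "inj_on x {1..5}"
    using x(1) by (auto simp: basis5_def)
  \<comment> \<open>The basis just found makes both spaces finite-dimensional, and equal dimensions
    provide a linear isomorphism.\<close>
  interpret finite_dimensional_vector_space_pair scale "x ` {1..5}" "(*s)" "cart_basis :: (complex^5) set"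
    by unfold_locales (use ind span in auto)
  obtain f :: "'a \<Rightarrow> complex^5" where f: "Vector_Spaces.linear scale (*s) f" "f ` UNIV = UNIV" "inj f"
    using subspace_isomorphism[of UNIV UNIV] assms(5) by (auto simp: vec_dim_card simp del: vec.dim_UNIV)
  have bij: "bij f"
    using f by (simp add: bij_def)
  have f_simps: "f (a + b) = f a + f b" "f (scale c a) = c *s f a" "f 0 = 0" for a b c
    using f(1) by (auto simp: Vector_Spaces.linear_iff) (metis add_cancel_right_left)
  define g where "g = inv f"
  have fg: "f (g u) = u" "g (f a) = a" for u a
    using bij by (simp_all add: g_def bij_is_surj bij_is_inj surj_f_inv_f)
  have g_simps: "g (u + v) = g u + g v" "g (c *s u) = scale c (g u)" for u v c
    by (metis f_simps(1) fg) (metis f_simps(2) fg)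
  \<comment> \<open>Transport of structure: with this product \<open>f\<close> is an isomorphism by
    construction.\<close>
  define br where "br u v = f (bracket (g u) (g v))" for u v
  interpret L: leibniz_algebra "(*s)" br
  proof unfold_locales
    show "br a (br b c) = br (br a b) c + br b (br a c)" for a b c
      using leibniz[of "g a" "g b" "g c"] by (simp add: br_def fg flip: f_simps(1))
  qed (simp_all add: br_def g_simps f_simps bracket_simps)
  have "leibniz_isomorphic scale bracket (*s) br"
    unfolding leibniz_isomorphic_def using f(1) bij by (intro exI[of _ f]) (simp add: br_def fg)
  moreover have "L.basis5 (f \<circ> x)"
  proof -
    have image: "(f \<circ> x) ` {1..5} = f ` (x ` {1..5})"
      by (rule image_comp[symmetric])
    have "inj_on (f \<circ> x) {1..5}"
      using inj f(3) by (simp add: comp_inj_on inj_on_def)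
    moreover have "vec.independent (f ` (x ` {1..5}))"
      using linear_independent_injective_image[OF f(1) ind] f(3) by (simp add: inj_on_def)
    moreover have "vec.span (f ` (x ` {1..5})) = UNIV"
      using linear_span_image[OF f(1), of "x ` {1..5}"] span f(2) by simp
    ultimately show ?thesis
      unfolding L.basis5_def image by blast
  qed
  moreover have "L.products_given_by (f \<circ> x) T"
    using x(2) unfolding products_given_by_def L.products_given_by_def
    by (auto simp: br_def fg f_simps split: option.splits)
  moreover note L.leibniz_algebra_axioms
  ultimately show ?thesis
    using T
    by (intro exI[of _ br] exI[of _ "f \<circ> x"] conjI; (assumption | (elim listed.cases; blast)))
qed

end
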